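(* Let $\Omega_D$ be an axially symmetric open subset of $Q_A$ and let $\Omega:=\Omega_D\cap M$, an axially symmetric open subset of $M$. Assume that $m=\dim(M)-1$ is greater than $1$. Let $f:\Omega\to A$ be a slice function of class $\mathcal C^1(\Omega)$. If $A$ is not associative, assume that $f$ is $M$-admissible. Let $c_m=(1-m)/2$. Then the following properties hold on $\Omega\setminus\mathbb R$: (a) $\Gamma_{\mathcal B}f=(m-1)\,\mathrm{Im}(x)f'_s$. (b) $\overline\partial_{\mathcal B}f=\dfrac{\partial f}{\partial x^c}+c_m f'_s$. (c) $\partial_{\mathcal B}f=\dfrac{\partial f}{\partial x}-c_mf'_s$ and $\dfrac{\partial f'_s}{\partial x}=\partial_{\mathcal B}f'_s$. (d) $f$ is slice-regular if and only if $\overline\partial_{\mathcal B}f=c_mf'_s$. (e) $f\in\ker(\overline\partial_{\mathcal B})$ if and only if $\dfrac{\partial f}{\partial x^c}=-c_mf'_s$. (f) If $f$ is slice-regular, then $$\Delta_{\mathcal B}f=4c_m\frac{\partial f'_s}{\partial x}\qquad\text{and}\qquad \mathrm{Im}(x)\,\Delta_{\mathcal B}f=2c_m\Big(\frac{\partial f}{\partial x}-f'_s\Big).$$ (g) If $f\in\ker(\overline\partial_{\mathcal B})$ is slice-regular, then $f$ is locally constant. The same holds if $f\in\ker(\partial_{\mathcal B})$ and $f$ is anti-slice-regular, namely, it satisfies $\dfrac{\partial f}{\partial x}=0$. (h) If $f$ is slice-regular on $\Omega$ and $\Delta_{\mathcal B}f=0$, then $f$ is an affine function of the form $xa+b$,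 with $a,b\in A$.
   Context: $A$ is a finite-dimensional real alternative algebra with unity $1\ne0$ (the associator $(x,y,z)=(xy)z-x(yz)$ is alternating), $\mathbb R$ is identified with $\mathbb R\cdot 1$, and $A$ is a *-algebra with real linear anti-involution $x\mapsto x^c$, $(xy)^c=y^cx^c$, $x^c=x$ for $x\in\mathbb R$. Put $t(x)=x+x^c$, $n(x)=xx^c$, $\mathbb S_A=\{J\in A: t(J)=0,\ n(J)=1\}\neq\emptyset$, $\mathbb C_J=\mathrm{span}(1,J)$, $Q_A=\bigcup_{J\in\mathbb S_A}\mathbb C_J$. For $x\in Q_A$, $\mathrm{Re}(x)=\frac{x+x^c}2$, $\mathrm{Im}(x)=\frac{x-x^c}2$. $M$ is a real vector subspace of $A$ with $\mathbb R\subset M\subset Q_A$, $m=\dim(M)-1$. On $M$, $\langle x,y\rangle=\frac12t(xy^c)$ is a scalar product with $\|x\|^2=n(x)$. $\mathcal B=(v_0=1,v_1,\dots,v_m)$ is an orthonormal basis of $M$, $x=\sum_{i=0}^mx_iv_i$, $\partial_i$ is the partial derivative w.r.t. $x_i$ of $A$-valued functions (componentwise), and $$\overline\partial_{\mathcal B}=\tfrac12\Big(\partial_0+\sum_{i=1}^mv_i\partial_i\Big),\quad \partial_{\mathcal B}=\tfrac12\Big(\partial_0-\sum_{i=1}^mv_i\partial_i\Big),\quad \Delta_{\mathcal B}=\sum_{i=0}^m\partial_i^2,$$ $$\Gamma_{\mathcal B}f=-\tfrac12\sum_{i,j=1}^mv_i(v_jL_{ij}f),\quad L_{ij}=x_i\partial_j-x_j\partial_i.$$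 A $\mathcal C^1$ function $f:\Omega\to A$ is $M$-admissible if $f(x),\overline\partial_{\mathcal B}f(x)\in M$ for all $x\in\Omega$. Slice functions: let $D\subseteq\mathbb C$ be open and invariant under complex conjugation and $\Omega_D=\{\alpha+J\beta:\alpha,\beta\in\mathbb R,\ \alpha+i\beta\in D,\ J\in\mathbb S_A\}$ (axially symmetric open set). In $A\otimes_{\mathbb R}\mathbb C=\{a+\imath b: a,b\in A\}$, $\imath^2=-1$, put $\overline{a+\imath b}=a-\imath b$. A stem function is $F=F_1+\imath F_2:D\to A\otimes_{\mathbb R}\mathbb C$ with $F(\overline z)=\overline{F(z)}$; it induces the slice function $f=\mathcal I(F):\Omega_D\to A$, $f(\alpha+J\beta)=F_1(\alpha+i\beta)+JF_2(\alpha+i\beta)$. $f$ is slice-regular if $F$ is holomorphic w.r.t. left multiplication by $\imath$. The spherical derivative is $f'_s(x)=\frac12\mathrm{Im}(x)^{-1}(f(x)-f(x^c))$ for $x\notin\mathbb R$. The slice derivatives are $\frac{\partial f}{\partial x}=\mathcal I(\frac{\partial F}{\partial z})$, $\frac{\partial f}{\partial x^c}=\mathcal I(\frac{\partial F}{\partial\overline z})$, with $\frac{\partial}{\partial z}=\frac12(\partial_\alpha-\imath\partial_\beta)$, $\frac{\partial}{\partial\overline z}=\frac12(\partial_\alpha+\imath\partial_\beta)$. A slice (slice-regular) function on $\Omega=\Omega_D\cap M$ is the restriction of one on $\Omega_D$; the restriction determines the function on $\Omega_D$.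
   Formalization: In (h) the form xa+b is asserted on each connected component of Ω, with a, b depending on the component; a single global pair fails for disconnected Ω (f = 0 on one part, f = 1 on the other), and for connected Ω the claim is unchanged. *)

theory Defs
  imports "HOL-Analysis.Analysis"
begin

text \<open>
  Finite-dimensional real alternative *-algebras with unity. The class \<^class>\<open>euclidean_space\<close>
  only supplies finite-dimensionality and the canonical vector space topology; its inner product is
  an auxiliary one, unrelated to the algebra structure (compare \<open>scal\<close> below). The classes
  \<^class>\<open>times\<close> and \<^class>\<open>one\<close> are purely syntactic, so nothing but the listed axioms is assumed
  about the product. As no \<open>of_real\<close> is available for non-associative products, a real number \<open>r\<close>
  is identified with \<open>r *\<^sub>R 1\<close>.
\<close>

class alternative_star_algebra = euclidean_space + one + times +
  fixes aconj :: "'a \<Rightarrow> 'a"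
  assumes alg_add_left: "(x + y) * z = x * z + y * z"
    and alg_add_right: "x * (y + z) = x * y + x * z"
    and alg_scaleR_left: "(r *\<^sub>R x) * y = r *\<^sub>R (x * y)"
    and alg_scaleR_right: "x * (r *\<^sub>R y) = r *\<^sub>R (x * y)"
    and alg_one_left: "1 * x = x"
    and alg_one_right: "x * 1 = x"
    and alg_one_neq_zero: "1 \<noteq> 0"
    \<comment> \<open>the associator is alternating\<close>
    and alg_alt_left: "(x * x) * y - x * (x * y) = 0"
    and alg_alt_right: "(x * y) * y - x * (y * y) = 0"
    and alg_alt_flex: "(x * y) * x - x * (y * x) = 0"
    and aconj_add: "aconj (x + y) = aconj x + aconj y"
    and aconj_scaleR: "aconj (r *\<^sub>R x) = r *\<^sub>R aconj x"
    and aconj_aconj: "aconj (aconj x) = x"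
    and aconj_mult: "aconj (x * y) = aconj y * aconj x"
    and aconj_real: "aconj (r *\<^sub>R 1) = r *\<^sub>R 1"

definition real_line :: "'a::alternative_star_algebra set"
  where "real_line = range (\<lambda>r. r *\<^sub>R 1)"

definition alg_trace :: "'a::alternative_star_algebra \<Rightarrow> 'a"
  where "alg_trace x = x + aconj x"

definition alg_norm :: "'a::alternative_star_algebra \<Rightarrow> 'a"
  where "alg_norm x = x * aconj x"

definition imag_units :: "'a::alternative_star_algebra set"
  where "imag_units = {J. alg_trace J = 0 \<and> alg_norm J = 1}"

definition quadratic_cone :: "'a::alternative_star_algebra set"
  where "quadratic_cone = (\<Union>J\<in>imag_units. span {1, J})"

definition alg_Re :: "'a::alternative_star_algebra \<Rightarrow> 'a"
  where "alg_Re x = (1/2) *\<^sub>R (x + aconj x)"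

definition alg_Im :: "'a::alternative_star_algebra \<Rightarrow> 'a"
  where "alg_Im x = (1/2) *\<^sub>R (x - aconj x)"

definition alg_inverse :: "'a::alternative_star_algebra \<Rightarrow> 'a"
  where "alg_inverse x = (THE y. x * y = 1 \<and> y * x = 1)"

text \<open>The scalar product \<open>\<langle>x,y\<rangle> = t(x y\<^sup>c)/2\<close> of \<open>M\<close>, with its real value regarded as an element of
  the algebra.\<close>

definition scal :: "'a::alternative_star_algebra \<Rightarrow> 'a \<Rightarrow> 'a"
  where "scal x y = (1/2) *\<^sub>R alg_trace (x * aconj y)"

definition orthonormal_basis :: "'a::alternative_star_algebra set \<Rightarrow> nat \<Rightarrow> (nat \<Rightarrow> 'a) \<Rightarrow> bool"
  where "orthonormal_basis M m v \<longleftrightarrow>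
    v 0 = 1 \<and> span (v ` {..m}) = M \<and>
    (\<forall>i\<le>m. \<forall>j\<le>m. scal (v i) (v j) = (if i = j then 1 else 0))"


subsection \<open>Differential operators on functions of \<open>x = x\<^sub>0 v\<^sub>0 + \<dots> + x\<^sub>m v\<^sub>m\<close>\<close>

text \<open>Functions on \<open>\<Omega> \<subseteq> M\<close> are represented by functions on the whole type. At points of a relatively
  open \<open>\<Omega>\<close>, the operators below only depend on the values on \<open>\<Omega>\<close>.\<close>

definition coord :: "(nat \<Rightarrow> 'a::alternative_star_algebra) \<Rightarrow> nat \<Rightarrow> nat \<Rightarrow> 'a \<Rightarrow> real"
  where "coord v m i x = representation (v ` {..m}) x (v i)"

definition pderiv_dir :: "(nat \<Rightarrow> 'a::alternative_star_algebra) \<Rightarrow> nat \<Rightarrow> ('a \<Rightarrow> 'a) \<Rightarrow> 'a \<Rightarrow> 'a"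
  where "pderiv_dir v i f x = vector_derivative (\<lambda>s. f (x + s *\<^sub>R v i)) (at 0)"

definition dbar_op :: "(nat \<Rightarrow> 'a::alternative_star_algebra) \<Rightarrow> nat \<Rightarrow> ('a \<Rightarrow> 'a) \<Rightarrow> 'a \<Rightarrow> 'a"
  where "dbar_op v m f x =
    (1/2) *\<^sub>R (pderiv_dir v 0 f x + (\<Sum>i=1..m. v i * pderiv_dir v i f x))"

definition d_op :: "(nat \<Rightarrow> 'a::alternative_star_algebra) \<Rightarrow> nat \<Rightarrow> ('a \<Rightarrow> 'a) \<Rightarrow> 'a \<Rightarrow> 'a"
  where "d_op v m f x =
    (1/2) *\<^sub>R (pderiv_dir v 0 f x - (\<Sum>i=1..m. v i * pderiv_dir v i f x))"

definition laplace_op :: "(nat \<Rightarrow> 'a::alternative_star_algebra) \<Rightarrow> nat \<Rightarrow> ('a \<Rightarrow> 'a) \<Rightarrow> 'a \<Rightarrow> 'a"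
  where "laplace_op v m f x = (\<Sum>i=0..m. pderiv_dir v i (pderiv_dir v i f) x)"

definition L_op ::
    "(nat \<Rightarrow> 'a::alternative_star_algebra) \<Rightarrow> nat \<Rightarrow> nat \<Rightarrow> nat \<Rightarrow> ('a \<Rightarrow> 'a) \<Rightarrow> 'a \<Rightarrow> 'a"
  where "L_op v m i j f x =
    coord v m i x *\<^sub>R pderiv_dir v j f x - coord v m j x *\<^sub>R pderiv_dir v i f x"

definition Gamma_op :: "(nat \<Rightarrow> 'a::alternative_star_algebra) \<Rightarrow> nat \<Rightarrow> ('a \<Rightarrow> 'a) \<Rightarrow> 'a \<Rightarrow> 'a"
  where "Gamma_op v m f x = - ((1/2) *\<^sub>R (\<Sum>i=1..m. \<Sum>j=1..m. v i * (v j * L_op v m i j f x)))"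

text \<open>For \<open>\<Omega>\<close> relatively open in \<open>M\<close>, derivatives within \<open>\<Omega>\<close> are determined on \<open>M\<close> only; a continuous
  choice of them on the ambient space exists if and only if the derivatives along \<open>M\<close> are
  continuous.\<close>

definition C1_on :: "'a::alternative_star_algebra set \<Rightarrow> ('a \<Rightarrow> 'a) \<Rightarrow> bool"
  where "C1_on \<Omega> f \<longleftrightarrow>
    (\<exists>f' :: 'a \<Rightarrow> 'a \<Rightarrow>\<^sub>L 'a.
      (\<forall>x\<in>\<Omega>. (f has_derivative blinfun_apply (f' x)) (at x within \<Omega>)) \<and> continuous_on \<Omega> f')"

definition admissible ::
    "'a::alternative_star_algebra set \<Rightarrow> (nat \<Rightarrow> 'a) \<Rightarrow> nat \<Rightarrow> 'a set \<Rightarrow> ('a \<Rightarrow> 'a) \<Rightarrow> bool"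
  where "admissible M v m \<Omega> f \<longleftrightarrow> C1_on \<Omega> f \<and> (\<forall>x\<in>\<Omega>. f x \<in> M \<and> dbar_op v m f x \<in> M)"

definition locally_constant_on :: "'a::topological_space set \<Rightarrow> ('a \<Rightarrow> 'b) \<Rightarrow> bool"
  where "locally_constant_on S f \<longleftrightarrow>
    (\<forall>x\<in>S. \<exists>U. openin (top_of_set S) U \<and> x \<in> U \<and> f constant_on U)"


subsection \<open>Slice functions\<close>

definition axial_set :: "complex set \<Rightarrow> 'a::alternative_star_algebra set"
  where "axial_set D = {\<alpha> *\<^sub>R 1 + \<beta> *\<^sub>R J | \<alpha> \<beta> J. Complex \<alpha> \<beta> \<in> D \<and> J \<in> imag_units}"

text \<open>The element \<open>a + \<iota> b\<close> of the complexified algebra is encoded as the pair \<open>(a, b)\<close>.\<close>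

definition iota_mult :: "'a::alternative_star_algebra \<times> 'a \<Rightarrow> 'a \<times> 'a"
  where "iota_mult w = (- snd w, fst w)"

definition cplx_bar :: "'a::alternative_star_algebra \<times> 'a \<Rightarrow> 'a \<times> 'a"
  where "cplx_bar w = (fst w, - snd w)"

definition stem_function :: "complex set \<Rightarrow> (complex \<Rightarrow> 'a::alternative_star_algebra \<times> 'a) \<Rightarrow> bool"
  where "stem_function D F \<longleftrightarrow> (\<forall>z\<in>D. F (cnj z) = cplx_bar (F z))"

definition stem_holomorphic :: "complex set \<Rightarrow> (complex \<Rightarrow> 'a::alternative_star_algebra \<times> 'a) \<Rightarrow> bool"
  where "stem_holomorphic D F \<longleftrightarrow>
    (\<forall>z\<in>D. \<exists>F'. (F has_derivative F') (at z) \<and> (\<forall>w. F' (\<i> * w) = iota_mult (F' w)))"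

text \<open>The value is independent of the representation \<open>x = \<alpha> + J \<beta>\<close> when \<open>x\<close> lies in \<open>axial_set D\<close>
  and \<open>F\<close> is a stem function on a conjugation-invariant \<open>D\<close>.\<close>

definition induced :: "(complex \<Rightarrow> 'a::alternative_star_algebra \<times> 'a) \<Rightarrow> 'a \<Rightarrow> 'a"
  where "induced F x =
    (THE y. \<exists>\<alpha> \<beta> J. J \<in> imag_units \<and> x = \<alpha> *\<^sub>R 1 + \<beta> *\<^sub>R J \<and>
       y = fst (F (Complex \<alpha> \<beta>)) + J * snd (F (Complex \<alpha> \<beta>)))"

definition stem_of_on ::
    "complex set \<Rightarrow> 'a::alternative_star_algebra set \<Rightarrow> ('a \<Rightarrow> 'a) \<Rightarrow> (complex \<Rightarrow> 'a \<times> 'a) \<Rightarrow> bool"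
  where "stem_of_on D M f F \<longleftrightarrow>
    stem_function D F \<and> (\<forall>x\<in>axial_set D \<inter> M. f x = induced F x)"

definition slice_function :: "complex set \<Rightarrow> 'a::alternative_star_algebra set \<Rightarrow> ('a \<Rightarrow> 'a) \<Rightarrow> bool"
  where "slice_function D M f \<longleftrightarrow> (\<exists>F. stem_of_on D M f F)"

definition slice_regular :: "complex set \<Rightarrow> 'a::alternative_star_algebra set \<Rightarrow> ('a \<Rightarrow> 'a) \<Rightarrow> bool"
  where "slice_regular D M f \<longleftrightarrow> (\<exists>F. stem_of_on D M f F \<and> stem_holomorphic D F)"

definition stem_dalpha :: "(complex \<Rightarrow> 'a::alternative_star_algebra \<times> 'a) \<Rightarrow> complex \<Rightarrow> 'a \<times> 'a"
  where "stem_dalpha F z = vector_derivative (\<lambda>s. F (z + of_real s)) (at 0)"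

definition stem_dbeta :: "(complex \<Rightarrow> 'a::alternative_star_algebra \<times> 'a) \<Rightarrow> complex \<Rightarrow> 'a \<times> 'a"
  where "stem_dbeta F z = vector_derivative (\<lambda>s. F (z + \<i> * of_real s)) (at 0)"

definition stem_dz :: "(complex \<Rightarrow> 'a::alternative_star_algebra \<times> 'a) \<Rightarrow> complex \<Rightarrow> 'a \<times> 'a"
  where "stem_dz F z = (1/2) *\<^sub>R (stem_dalpha F z - iota_mult (stem_dbeta F z))"

definition stem_dzbar :: "(complex \<Rightarrow> 'a::alternative_star_algebra \<times> 'a) \<Rightarrow> complex \<Rightarrow> 'a \<times> 'a"
  where "stem_dzbar F z = (1/2) *\<^sub>R (stem_dalpha F z + iota_mult (stem_dbeta F z))"

text \<open>If \<open>M\<close> contains an imaginary unit, the restriction of a slice function to \<open>axial_set D \<inter> M\<close>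
  determines its stem function on \<open>D\<close>, so that the choice below is immaterial on an open \<open>D\<close>.\<close>

definition slice_dx ::
    "complex set \<Rightarrow> 'a::alternative_star_algebra set \<Rightarrow> ('a \<Rightarrow> 'a) \<Rightarrow> 'a \<Rightarrow> 'a"
  where "slice_dx D M f = induced (stem_dz (SOME F. stem_of_on D M f F))"

definition slice_dxc ::
    "complex set \<Rightarrow> 'a::alternative_star_algebra set \<Rightarrow> ('a \<Rightarrow> 'a) \<Rightarrow> 'a \<Rightarrow> 'a"
  where "slice_dxc D M f = induced (stem_dzbar (SOME F. stem_of_on D M f F))"

definition spherical_deriv :: "('a::alternative_star_algebra \<Rightarrow> 'a) \<Rightarrow> 'a \<Rightarrow> 'a"
  where "spherical_deriv f x = (1/2) *\<^sub>R (alg_inverse (alg_Im x) * (f x - f (aconj x)))"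

end

theory Submission
  imports Defs "HOL-Complex_Analysis.Cauchy_Integral_Formula"
begin

text \<open>
  Write \<open>\<beta>\<close> for the norm of \<open>Im x\<close>, \<open>J = Im x / \<beta>\<close> and \<open>G = F\<^sub>2 / \<beta>\<close>, so that a slice function is
  \<open>f x = F\<^sub>1 + Im x G\<close> with \<open>F\<^sub>1\<close> and \<open>G = f\<^sub>s'\<close> depending on \<open>x\<^sub>0\<close> and \<open>\<beta>\<close> only. The left
  alternative law linearizes to \<open>v\<^sub>i (v\<^sub>j y) + v\<^sub>j (v\<^sub>i y) = - 2 \<delta>\<^sub>i\<^sub>j y\<close>: left multiplications by the
  basis satisfy the Clifford relations even when the algebra is not associative, and no other product
  has to be reassociated. Together with \<open>\<partial>\<^sub>i \<beta> = x\<^sub>i / \<beta>\<close> they reduce the differential operators to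
  expressions in the partial derivatives of \<open>F\<^sub>1\<close> and \<open>G\<close> in \<open>\<alpha>\<close> and \<open>\<beta>\<close>. Evaluating at \<open>x\<close> and at
  \<open>x\<^sup>c\<close> recovers the stem function, and continuity carries identities over to the real axis.
\<close>

subsection \<open>Alternative *-algebras and induced functions\<close>

text \<open>The constant \<open>(1 - m) / 2\<close> is a balance in the Dirac sum of
  \<open>Im x G\<close>. Differentiating \<open>Im x\<close> gives \<open>v_i (v_i G) = - G\<close>
  once for each of the m directions, while the radial derivative of \<open>G = F_2 / \<beta>\<close>
  gives back a single \<open>+ G\<close> from the factor \<open>1 / \<beta>\<close>. Three obstacles
  shape the proof. First, \<open>G\<close> divides by \<beta>, so all computations take place on
  \<open>D - \<real>\<close>, and a conclusion about the whole domain must be phrased for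
  \<open>F\<close> and \<open>F'\<close>, which are continuous across the axis. Second, class C1
  supplies only first derivatives; the second derivatives in the Laplacian come from holomorphy,
  through Cauchy's theory for complex-valued components. Third, the slice notions quantify over or
  choose a stem function; since the values on the single slice spanned by 1 and \<open>v 1\<close>
  determine it on D, one fixed \<open>F\<close> with derivative \<open>F'\<close> can serve for all
  of them.\<close>

lemma bounded_bilinear_alg_mult:
  "bounded_bilinear ((*) :: 'a::alternative_star_algebra \<Rightarrow> 'a \<Rightarrow> 'a)"
  unfolding bilinear_conv_bounded_bilinear[symmetric] bilinear_def
  by (auto intro!: linearI simp: alg_add_left alg_add_right alg_scaleR_left alg_scaleR_right)

interpretation alg: bounded_bilinear "(*) :: 'a::alternative_star_algebra \<Rightarrow> 'a \<Rightarrow> 'a"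
  by (rule bounded_bilinear_alg_mult)

lemma bounded_linear_aconj: "bounded_linear (aconj :: 'a::alternative_star_algebra \<Rightarrow> 'a)"
  unfolding linear_conv_bounded_linear[symmetric]
  by (rule linearI) (simp_all add: aconj_add aconj_scaleR)

lemmas aconj_minus = linear_neg[OF bounded_linear.linear[OF bounded_linear_aconj]]

lemma aconj_one: "aconj 1 = (1::'a::alternative_star_algebra)"
  using aconj_real[of 1, where ?'a='a] by simp

lemma alg_mult_self_left: "x * (x * y) = (x * x) * (y :: 'a::alternative_star_algebra)"
  using alg_alt_left[of x y] by simp

text \<open>This turns the left multiplications by an orthonormal family of imaginary units into a
  representation of a Clifford algebra.\<close>
lemma alg_alt_left_linearized:
  "a * (b * y) + b * (a * y) = (a * b + b * a) * (y :: 'a::alternative_star_algebra)"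
  using alg_mult_self_left[of "a + b" y] alg_mult_self_left[of a y] alg_mult_self_left[of b y]
  by (simp add: alg_add_left alg_add_right add.commute)

declare alg_one_neq_zero [simp]

lemma scaleR_one_inject:
  "r *\<^sub>R (1::'a::alternative_star_algebra) = s *\<^sub>R 1 \<longleftrightarrow> r = s"
  by simp

lemma imag_unitsD:
  assumes "J \<in> (imag_units :: 'a::alternative_star_algebra set)"
  shows "aconj J = - J" and "J * J = - 1" and "J * (J * y) = - y"
proof -
  show *: "aconj J = - J"
    using assms by (simp add: imag_units_def alg_trace_def eq_neg_iff_add_eq_0 add.commute)
  have "- (J * J) = 1"
    using assms * by (simp add: imag_units_def alg_norm_def alg.minus_right)
  then show "J * J = - 1"
    by (metis minus_minus)
  then show "J * (J * y) = - y"
    by (simp add: alg_mult_self_left alg.minus_left alg_one_left)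
qed

lemma imag_unitsI: "aconj J = - J \<Longrightarrow> J * J = - 1 \<Longrightarrow> J \<in> imag_units"
  by (simp add: imag_units_def alg_trace_def alg_norm_def alg.minus_right)

lemma uminus_imag_units: "J \<in> imag_units \<Longrightarrow> - J \<in> imag_units"
  by (rule imag_unitsI) (simp_all add: imag_unitsD aconj_minus alg.minus_left alg.minus_right)

text \<open>Conjugation fixes the real part and negates the rest, which separates the two; squaring
  the imaginary part then determines \<beta> up to sign.\<close>

lemma slice_representation_unique:
  fixes J J' :: "'a::alternative_star_algebra"
  assumes J: "J \<in> imag_units" "J' \<in> imag_units"
    and eq: "\<alpha> *\<^sub>R 1 + \<beta> *\<^sub>R J = \<alpha>' *\<^sub>R 1 + \<beta>' *\<^sub>R J'"
  shows "\<alpha>' = \<alpha>" and "\<beta>' *\<^sub>R J' = \<beta> *\<^sub>R J" and "\<beta>' = \<beta> \<or> \<beta>' = - \<beta>"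
proof -
  have "aconj (\<alpha> *\<^sub>R 1 + \<beta> *\<^sub>R J) = aconj (\<alpha>' *\<^sub>R 1 + \<beta>' *\<^sub>R J')"
    by (simp only: eq)
  then have "\<alpha> *\<^sub>R 1 - \<beta> *\<^sub>R J = \<alpha>' *\<^sub>R 1 - \<beta>' *\<^sub>R J'"
    using J by (simp add: aconj_add aconj_scaleR aconj_one imag_unitsD)
  from arg_cong2[OF eq this, of plus]
  have sum_eq: "(\<alpha> *\<^sub>R 1 + \<beta> *\<^sub>R J) + (\<alpha> *\<^sub>R 1 - \<beta> *\<^sub>R J) =
      (\<alpha>' *\<^sub>R 1 + \<beta>' *\<^sub>R J') + (\<alpha>' *\<^sub>R 1 - \<beta>' *\<^sub>R J')" .
  have double: "(r *\<^sub>R 1 + y) + (r *\<^sub>R 1 - y) = (2 * r) *\<^sub>R (1::'a)" for r y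
    by (simp add: scaleR_2 flip: scaleR_scaleR)
  have "(2 * \<alpha>) *\<^sub>R (1::'a) = (2 * \<alpha>') *\<^sub>R 1"
    using sum_eq by (simp only: double)
  then show \<alpha>: "\<alpha>' = \<alpha>"
    by (simp add: scaleR_one_inject)
  then show *: "\<beta>' *\<^sub>R J' = \<beta> *\<^sub>R J"
    using eq by simp
  then have "(\<beta>' *\<^sub>R J') * (\<beta>' *\<^sub>R J') = (\<beta> *\<^sub>R J) * (\<beta> *\<^sub>R J)"
    by simp
  then have "(- (\<beta>' * \<beta>')) *\<^sub>R (1::'a) = (- (\<beta> * \<beta>)) *\<^sub>R 1"
    using J by (simp add: alg_scaleR_left alg_scaleR_right imag_unitsD)
  then have "\<beta>' * \<beta>' = \<beta> * \<beta>"
    by (subst (asm) scaleR_one_inject) simp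
  then show "\<beta>' = \<beta> \<or> \<beta>' = - \<beta>"
    by (simp add: square_eq_iff)
qed

text \<open>Makes the definite description in \<open>induced\<close> usable. Replacing (\<beta>, J)
  by their negatives is compensated by the symmetry of F, and for \<beta> = 0, where J is arbitrary,
  the same symmetry forces the second component to vanish. The symmetry is needed only at the point
  in question, so no domain appears.\<close>

lemma induced_eq:
  fixes J :: "'a::alternative_star_algebra"
  assumes J: "J \<in> imag_units" and F: "F (Complex \<alpha> (- \<beta>)) = cplx_bar (F (Complex \<alpha> \<beta>))"
  shows "induced F (\<alpha> *\<^sub>R 1 + \<beta> *\<^sub>R J) = fst (F (Complex \<alpha> \<beta>)) + J * snd (F (Complex \<alpha> \<beta>))"
  unfolding induced_def
proof (rule the_equality)
  show "\<exists>\<alpha>' \<beta>' J'. J' \<in> imag_units \<and> \<alpha> *\<^sub>R 1 + \<beta> *\<^sub>R J = \<alpha>' *\<^sub>R 1 + \<beta>' *\<^sub>R J' \<and>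
      fst (F (Complex \<alpha> \<beta>)) + J * snd (F (Complex \<alpha> \<beta>)) =
      fst (F (Complex \<alpha>' \<beta>')) + J' * snd (F (Complex \<alpha>' \<beta>'))"
    using J by blast
next
  fix y
  assume "\<exists>\<alpha>' \<beta>' J'. J' \<in> imag_units \<and> \<alpha> *\<^sub>R 1 + \<beta> *\<^sub>R J = \<alpha>' *\<^sub>R 1 + \<beta>' *\<^sub>R J' \<and>
      y = fst (F (Complex \<alpha>' \<beta>')) + J' * snd (F (Complex \<alpha>' \<beta>'))"
  then obtain \<alpha>' \<beta>' J' where J': "J' \<in> imag_units"
    and eq: "\<alpha> *\<^sub>R 1 + \<beta> *\<^sub>R J = \<alpha>' *\<^sub>R 1 + \<beta>' *\<^sub>R J'"
    and y: "y = fst (F (Complex \<alpha>' \<beta>')) + J' * snd (F (Complex \<alpha>' \<beta>'))"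
    by blast
  note u = slice_representation_unique[OF J J' eq]
  show "y = fst (F (Complex \<alpha> \<beta>)) + J * snd (F (Complex \<alpha> \<beta>))"
  proof (cases "\<beta> = 0")
    case True
    have "snd (F (Complex \<alpha> 0)) = - snd (F (Complex \<alpha> 0))"
      using arg_cong[OF F, of snd] True by (simp add: cplx_bar_def)
    then have "snd (F (Complex \<alpha> 0)) = 0"
      by (metis add.right_inverse scaleR_2 scaleR_eq_0_iff zero_neq_numeral)
    then show ?thesis
      using u y True by (auto simp: alg.zero_right)
  next
    case False
    from u(3) show ?thesis
    proof
      assume *: "\<beta>' = \<beta>"
      then have "J' = J"
        using u(2) False by simp
      then show ?thesis
        using y u(1) * by simp
    next
      assume *: "\<beta>' = - \<beta>"
      then have "\<beta> *\<^sub>R J' = \<beta> *\<^sub>R (- J)"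
        using u(2) by (metis minus_equation_iff scaleR_minus_left scaleR_minus_right)
      then have "J' = - J"
        using False by (subst (asm) scaleR_cancel_left) simp
      then show ?thesis
        using y u(1) * F by (simp add: cplx_bar_def alg.minus_left alg.minus_right)
    qed
  qed
qed

text \<open>Uniqueness of the inverse is not automatic without associativity; here it holds because
  left multiplication by J squares to minus the identity, so J can be cancelled on the left.\<close>

lemma alg_inverse_scaleR_imag_unit:
  assumes J: "J \<in> imag_units" and "\<beta> \<noteq> 0"
  shows "alg_inverse (\<beta> *\<^sub>R J) = (- (1 / \<beta>)) *\<^sub>R J"
  unfolding alg_inverse_def
proof (rule the_equality)
  show "(\<beta> *\<^sub>R J) * ((- (1 / \<beta>)) *\<^sub>R J) = 1 \<and> ((- (1 / \<beta>)) *\<^sub>R J) * (\<beta> *\<^sub>R J) = 1"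
    using assms by (simp add: alg_scaleR_left alg_scaleR_right imag_unitsD alg.minus_right alg.minus_left)
next
  fix y assume "(\<beta> *\<^sub>R J) * y = 1 \<and> y * (\<beta> *\<^sub>R J) = 1"
  then have "J * (\<beta> *\<^sub>R (J * y)) = J"
    by (simp add: alg_scaleR_left alg_one_right)
  then have "J = (- \<beta>) *\<^sub>R y"
    using J by (simp add: alg_scaleR_right imag_unitsD)
  then show "y = (- (1 / \<beta>)) *\<^sub>R J"
    using \<open>\<beta> \<noteq> 0\<close> by simp
qed

subsection \<open>Orthonormal bases and Clifford relations\<close>

locale orthonormal_frame =
  fixes v :: "nat \<Rightarrow> 'a::alternative_star_algebra" and m :: nat
  assumes v_0: "v 0 = 1"
    and m_pos: "1 \<le> m"
    and scal_v: "i \<le> m \<Longrightarrow> j \<le> m \<Longrightarrow> scal (v i) (v j) = (if i = j then 1 else 0)"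
begin

abbreviation M :: "'a set" where "M \<equiv> span (v ` {..m})"

text \<open>On M the scalar product is a real multiple of 1, and the auxiliary inner product with 1
  reads off the factor. Unlike \<open>coord\<close>, which comes from a basis representation, this
  is a bounded linear functional on the whole algebra and can be differentiated directly.\<close>

definition X :: "nat \<Rightarrow> 'a \<Rightarrow> real"
  where "X i x = (scal x (v i) \<bullet> 1) / ((1::'a) \<bullet> 1)"

definition V :: "'a \<Rightarrow> 'a"
  where "V x = (\<Sum>i=1..m. X i x *\<^sub>R v i)"

definition N :: "'a \<Rightarrow> real"
  where "N x = sqrt (\<Sum>i=1..m. (X i x)\<^sup>2)"

text \<open>The representative of x in the closed upper half-plane, which removes the sign ambiguity
  of \<beta>. It is continuous everywhere, in contrast to \<open>unit\<close>.\<close>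

definition pt :: "'a \<Rightarrow> complex"
  where "pt x = Complex (X 0 x) (N x)"

text \<open>On the real line, where the direction of the imaginary part is undefined, the value is an
  arbitrary imaginary unit of \<open>M\<close>.\<close>
definition unit :: "'a \<Rightarrow> 'a"
  where "unit x = (if N x = 0 then v 1 else (1 / N x) *\<^sub>R V x)"

lemma v_in_M: "i \<le> m \<Longrightarrow> v i \<in> M"
  by (auto intro: span_base)

lemma one_in_M: "1 \<in> M"
  using v_in_M[of 0] by (simp add: v_0)

lemma aconj_v:
  assumes "i \<in> {1..m}"
  shows "aconj (v i) = - v i"
proof -
  have "scal (v i) (v 0) = 0"
    using assms by (subst scal_v) auto
  then show ?thesis
    by (simp add: scal_def alg_trace_def v_0 aconj_one alg_one_right eq_neg_iff_add_eq_0 add.commute)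
qed

lemma v_imag_unit:
  assumes "i \<in> {1..m}"
  shows "v i \<in> imag_units"
proof -
  have "scal (v i) (v i) = 1"
    using assms by (subst scal_v) auto
  then have "(1/2) *\<^sub>R (v i * aconj (v i) + v i * aconj (v i)) = 1"
    by (simp add: scal_def alg_trace_def aconj_mult aconj_aconj)
  then have "v i * aconj (v i) = 1"
    by (simp flip: scaleR_2)
  then show ?thesis
    by (simp add: imag_units_def alg_norm_def alg_trace_def aconj_v[OF assms])
qed

text \<open>For distinct indices orthogonality says that \<open>v i\<close> and \<open>v j\<close>
  anticommute, and linearized alternativity lifts this to left multiplications acting on an
  arbitrary y.\<close>

lemma v_clifford:
  assumes "i \<in> {1..m}" "j \<in> {1..m}"
  shows "v i * (v j * y) = - (v j * (v i * y)) - (if i = j then 2 else 0) *\<^sub>R y"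
proof (cases "i = j")
  case True
  then show ?thesis
    using imag_unitsD(3)[OF v_imag_unit] assms by (simp add: scaleR_2)
next
  case False
  have "scal (v i) (v j) = 0"
    using assms False by (subst scal_v) auto
  then have "v i * aconj (v j) + v j * aconj (v i) = 0"
    by (simp add: scal_def alg_trace_def aconj_mult aconj_aconj)
  then have "- (v i * v j) + - (v j * v i) = 0"
    by (simp add: aconj_v[OF assms(1)] aconj_v[OF assms(2)]
        alg.minus_right)
  then have *: "v i * v j + v j * v i = 0"
    by (metis add.commute minus_add_distrib neg_equal_0_iff_equal)
  show ?thesis
    using alg_alt_left_linearized[of "v i" "v j" y] False
    by (simp add: * alg.zero_left eq_neg_iff_add_eq_0)
qed

lemma v_v: "i \<in> {1..m} \<Longrightarrow> v i * (v i * y) = - y"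
  using imag_unitsD(3)[OF v_imag_unit] .

lemma bounded_linear_X: "bounded_linear (X i)"
  unfolding X_def scal_def alg_trace_def
  by (intro bounded_linear_divide[THEN bounded_linear_compose] bounded_linear_inner_left_comp
      bounded_linear_scaleR_right[THEN bounded_linear_compose] bounded_linear_add
      alg.bounded_linear_left bounded_linear_aconj[THEN bounded_linear_compose])

lemmas linear_X = bounded_linear.linear[OF bounded_linear_X]
lemmas X_simps = linear_add[OF linear_X] linear_scale[OF linear_X] linear_neg[OF linear_X]
  linear_diff[OF linear_X] linear_sum[OF linear_X] linear_0[OF linear_X]

lemma X_v: "i \<le> m \<Longrightarrow> j \<le> m \<Longrightarrow> X i (v j) = (if i = j then 1 else 0)"
  by (simp add: X_def scal_v)

lemma bounded_linear_V: "bounded_linear V"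
  unfolding V_def
  by (intro bounded_linear_sum bounded_linear_scaleR_left[THEN bounded_linear_compose] bounded_linear_X)

lemmas linear_V = bounded_linear.linear[OF bounded_linear_V]
lemmas V_simps = linear_add[OF linear_V] linear_scale[OF linear_V] linear_neg[OF linear_V]
  linear_diff[OF linear_V] linear_0[OF linear_V]

lemma V_v: "i \<le> m \<Longrightarrow> V (v i) = (if i = 0 then 0 else v i)"
  by (auto simp: V_def X_v if_distrib[of "\<lambda>r. r *\<^sub>R _"] cong: if_cong)

lemma X_one: "X 0 1 = 1" "i \<in> {1..m} \<Longrightarrow> X i 1 = 0"
  using X_v[of 0 0] X_v[of i 0] by (auto simp: v_0)

lemma X_V: "i \<in> {1..m} \<Longrightarrow> X i (V x) = X i x" "X 0 (V x) = 0"
  by (auto simp: V_def X_simps X_v if_distrib[of "\<lambda>r. _ * r"] cong: if_cong)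

lemma M_expand:
  assumes "x \<in> M"
  shows "x = X 0 x *\<^sub>R 1 + V x"
proof -
  have "linear (\<lambda>x. X 0 x *\<^sub>R 1 + V x)"
    by (intro linear_compose_add linear_V bounded_linear.linear[OF bounded_linear_compose[OF bounded_linear_scaleR_left bounded_linear_X]])
  then have "id x = X 0 x *\<^sub>R 1 + V x"
    by (rule linear_eq_on[OF linear_id _ assms]) (auto simp: V_v X_v v_0)
  then show ?thesis
    by simp
qed

lemma independent_v: "inj_on v {..m}" "independent (v ` {..m})"
proof -
  show inj: "inj_on v {..m}"
  proof (rule inj_onI)
    fix i j assume "i \<in> {..m}" "j \<in> {..m}" "v i = v j"
    then show "i = j"
      using X_v[of i j] X_v[of i i] by (auto split: if_splits)
  qed
  show "independent (v ` {..m})"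
  proof (rule independent_if_scalars_zero)
    fix u x assume *: "(\<Sum>x\<in>v ` {..m}. u x *\<^sub>R x) = 0" and "x \<in> v ` {..m}"
    then obtain i where i: "i \<le> m" "x = v i"
      by auto
    have "(\<Sum>j\<le>m. u (v j) *\<^sub>R v j) = 0"
      using * by (simp add: sum.reindex[OF inj])
    then have "X i (\<Sum>j\<le>m. u (v j) *\<^sub>R v j) = 0"
      by (simp add: X_simps)
    then show "u x = 0"
      using i by (simp add: X_simps X_v if_distrib[of "\<lambda>r. _ * r"] cong: if_cong)
  qed simp
qed

lemma coord_eq:
  assumes "x \<in> M" "i \<le> m"
  shows "coord v m i x = X i x"
proof -
  have "x = (\<Sum>b\<in>v ` {..m}. representation (v ` {..m}) x b *\<^sub>R b)"
    by (rule sum_representation_eq[OF independent_v(2) assms(1), symmetric]) auto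
  then have "x = (\<Sum>j\<le>m. coord v m j x *\<^sub>R v j)"
    by (simp add: sum.reindex[OF independent_v(1)] coord_def)
  then have "X i x = X i (\<Sum>j\<le>m. coord v m j x *\<^sub>R v j)"
    by simp
  then show ?thesis
    using assms(2) by (simp add: X_simps X_v if_distrib[of "\<lambda>r. _ * r"] cong: if_cong)
qed

lemma N_ge_0: "0 \<le> N x"
  by (simp add: N_def sum_nonneg)

lemma N_sq: "(N x)\<^sup>2 = (\<Sum>i=1..m. (X i x)\<^sup>2)"
  by (simp add: N_def sum_nonneg)

text \<open>Expanding gives a double sum S with symmetric coefficients. The Clifford relation turns
  S into minus itself with the indices exchanged, up to the diagonal terms, so 2 S is determined by
  the diagonal.\<close>

lemma V_V: "V x * (V x * y) = - ((N x)\<^sup>2 *\<^sub>R y)"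
proof -
  define S where "S = (\<Sum>i=1..m. \<Sum>j=1..m. (X i x * X j x) *\<^sub>R (v i * (v j * y)))"
  have S: "V x * (V x * y) = S"
    unfolding S_def
    by (subst sum.swap) (simp add: V_def alg.sum_left alg.sum_right alg_scaleR_left alg_scaleR_right
        scaleR_sum_right mult.commute)
  have "S = (\<Sum>i=1..m. \<Sum>j=1..m. - ((X i x * X j x) *\<^sub>R (v j * (v i * y)))
              - (X i x * X j x * (if i = j then 2 else 0)) *\<^sub>R y)"
    unfolding S_def
    by (intro sum.cong refl) (subst v_clifford, assumption, assumption, simp add: scaleR_diff_right)
  also have "\<dots> = - (\<Sum>i=1..m. \<Sum>j=1..m. (X i x * X j x) *\<^sub>R (v j * (v i * y)))
      - (\<Sum>i=1..m. \<Sum>j=1..m. (X i x * X j x * (if i = j then 2 else 0)) *\<^sub>R y)"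
    by (simp only: sum_subtractf sum_negf)
  also have "(\<Sum>i=1..m. \<Sum>j=1..m. (X i x * X j x) *\<^sub>R (v j * (v i * y))) = S"
    unfolding S_def by (rule trans[OF sum.swap]) (simp add: mult.commute)
  also have "(\<Sum>i=1..m. \<Sum>j=1..m. (X i x * X j x * (if i = j then 2 else 0)) *\<^sub>R y) =
      (\<Sum>i=1..m. (2 * (X i x)\<^sup>2) *\<^sub>R y)"
  proof (intro sum.cong refl)
    fix i assume i: "i \<in> {1..m}"
    have "(\<Sum>j=1..m. (X i x * X j x * (if i = j then 2 else 0)) *\<^sub>R y) =
        (\<Sum>j=1..m. if i = j then (2 * (X i x)\<^sup>2) *\<^sub>R y else 0)"
      by (intro sum.cong refl) (simp add: power2_eq_square)
    then show "(\<Sum>j=1..m. (X i x * X j x * (if i = j then 2 else 0)) *\<^sub>R y) = (2 * (X i x)\<^sup>2) *\<^sub>R y"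
      using i by simp
  qed
  also have "\<dots> = 2 *\<^sub>R ((N x)\<^sup>2 *\<^sub>R y)"
    by (simp add: N_sq scaleR_sum_left sum_distrib_left scaleR_sum_right)
  finally have "S + S = - (2 *\<^sub>R ((N x)\<^sup>2 *\<^sub>R y))"
    by (metis add.commute add_diff_cancel_left' diff_add_cancel minus_diff_eq uminus_add_conv_diff)
  then have "2 *\<^sub>R S = 2 *\<^sub>R (- ((N x)\<^sup>2 *\<^sub>R y))"
    by (simp only: scaleR_2[of S] scaleR_minus_right)
  then have "S = - ((N x)\<^sup>2 *\<^sub>R y)"
    by (subst (asm) scaleR_cancel_left) simp
  then show ?thesis
    using S by simp
qed

lemma aconj_V: "aconj (V x) = - V x"
  unfolding V_def using aconj_v
  by (simp add: linear_sum[OF bounded_linear.linear[OF bounded_linear_aconj]] aconj_scaleR sum_negf)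

lemma N_eq_0: "N x = 0 \<Longrightarrow> i \<in> {1..m} \<Longrightarrow> X i x = 0"
  by (simp add: N_def sum_nonneg_eq_0_iff)

lemma unit_imag_unit: "unit x \<in> imag_units"
proof (cases "N x = 0")
  case True
  then show ?thesis
    using v_imag_unit[of 1] m_pos by (simp add: unit_def)
next
  case False
  show ?thesis
  proof (rule imag_unitsI)
    show "aconj (unit x) = - unit x"
      using False by (simp add: unit_def aconj_scaleR aconj_V)
    show "unit x * unit x = - 1"
      using V_V[of x 1] False
      by (simp add: unit_def alg_scaleR_left alg_scaleR_right alg_one_right power2_eq_square)
  qed
qed

lemma N_unit: "N x *\<^sub>R unit x = V x"
  by (auto simp: unit_def V_def N_eq_0)

lemma M_polar: "x \<in> M \<Longrightarrow> x = Re (pt x) *\<^sub>R 1 + Im (pt x) *\<^sub>R unit x"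
  using M_expand[of x] by (simp add: pt_def N_unit)

lemma pt_unique:
  assumes "x \<in> M" "J \<in> imag_units" "x = \<alpha> *\<^sub>R 1 + \<beta> *\<^sub>R J"
  shows "Complex \<alpha> \<beta> = pt x \<or> Complex \<alpha> \<beta> = cnj (pt x)"
  using slice_representation_unique[OF unit_imag_unit assms(2), of "Re (pt x)" "Im (pt x)" x \<alpha> \<beta>]
    M_polar[OF assms(1)] assms(3)
  by (auto simp: complex_eq_iff)

text \<open>A point of M has at most two complex representatives, \<open>pt x\<close> and its
  conjugate, so for conjugation-invariant D it suffices to test one.\<close>

lemma axial_set_iff:
  assumes "\<And>z. z \<in> D \<Longrightarrow> cnj z \<in> D" "x \<in> M"
  shows "x \<in> axial_set D \<longleftrightarrow> pt x \<in> D"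
proof
  assume "x \<in> axial_set D"
  then obtain \<alpha> \<beta> J where "J \<in> imag_units" "x = \<alpha> *\<^sub>R 1 + \<beta> *\<^sub>R J" "Complex \<alpha> \<beta> \<in> D"
    by (auto simp: axial_set_def)
  then show "pt x \<in> D"
    using pt_unique[OF assms(2)] assms(1) by (metis complex_cnj_cnj)
next
  assume "pt x \<in> D"
  then show "x \<in> axial_set D"
    using M_polar[OF assms(2)] unit_imag_unit[of x] by (force simp: axial_set_def)
qed

lemma real_line_iff:
  assumes "x \<in> M"
  shows "x \<in> real_line \<longleftrightarrow> N x = 0"
proof
  assume "x \<in> real_line"
  then obtain r where "x = r *\<^sub>R 1"
    by (auto simp: real_line_def)
  then show "N x = 0"
    by (simp add: N_def X_simps X_one)
next
  assume "N x = 0"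
  then have "x = X 0 x *\<^sub>R 1"
    using M_expand[OF assms] N_unit[of x] by simp
  then show "x \<in> real_line"
    by (auto simp: real_line_def)
qed

lemma pt_real_iff: "pt x \<in> \<real> \<longleftrightarrow> N x = 0"
  by (simp add: pt_def complex_is_Real_iff)

lemma continuous_on_pt: "continuous_on S pt"
  unfolding pt_def N_def complex_eq[symmetric]
  by (subst Complex_eq)
    (intro continuous_intros linear_continuous_on bounded_linear_X)

lemma aconj_M:
  assumes "x \<in> M"
  shows "aconj x = X 0 x *\<^sub>R 1 - V x"
proof -
  have "aconj x = aconj (X 0 x *\<^sub>R 1 + V x)"
    using M_expand[OF assms] by simp
  then show ?thesis
    by (simp add: aconj_add aconj_scaleR aconj_one aconj_V)
qed

lemma aconj_in_M: "x \<in> M \<Longrightarrow> aconj x \<in> M"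
  by (simp add: aconj_M V_def, intro span_diff span_scale span_sum one_in_M v_in_M) auto

lemma alg_Im_M:
  assumes "x \<in> M"
  shows "alg_Im x = V x"
proof -
  have "x - aconj x = (X 0 x *\<^sub>R 1 + V x) - (X 0 x *\<^sub>R 1 - V x)"
    using M_expand[OF assms] aconj_M[OF assms] by simp
  then show ?thesis
    by (simp add: alg_Im_def flip: scaleR_2)
qed

lemma X_aconj: "x \<in> M \<Longrightarrow> i \<in> {1..m} \<Longrightarrow> X i (aconj x) = - X i x"
  by (simp add: aconj_M X_simps X_one X_V)

lemma V_aconj: "x \<in> M \<Longrightarrow> V (aconj x) = - V x"
  by (simp add: V_def X_aconj sum_negf)

lemma pt_aconj: "x \<in> M \<Longrightarrow> pt (aconj x) = pt x"
  by (simp add: pt_def N_def X_aconj) (simp add: aconj_M X_simps X_one X_V)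

lemma pt_polar:
  assumes "i \<in> {1..m}" "0 \<le> \<beta>"
  shows "pt (\<alpha> *\<^sub>R 1 + \<beta> *\<^sub>R v i) = Complex \<alpha> \<beta>"
proof -
  have "(\<Sum>j=1..m. (X j (\<alpha> *\<^sub>R 1 + \<beta> *\<^sub>R v i))\<^sup>2) = (\<Sum>j=1..m. if j = i then \<beta>\<^sup>2 else 0)"
    using assms by (intro sum.cong refl) (auto simp: X_simps X_one X_v)
  then have "N (\<alpha> *\<^sub>R 1 + \<beta> *\<^sub>R v i) = \<beta>"
    using assms by (simp add: N_def)
  then show ?thesis
    using assms by (simp add: pt_def X_simps X_one X_v)
qed

end

subsection \<open>Differentiability of stem functions\<close>

lemma has_vector_derivative_compose:
  assumes "(f has_vector_derivative f') (at x)" "(g has_derivative g') (at (f x))"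
  shows "((\<lambda>s. g (f s)) has_vector_derivative g' f') (at x)"
  using vector_derivative_diff_chain_within[of f f' x UNIV g g'] assms
  by (simp add: o_def has_derivative_at_withinI)

lemma stem_dalpha_eq:
  assumes "(F has_derivative F') (at z)"
  shows "stem_dalpha F z = F' 1"
proof -
  have "((\<lambda>s. z + of_real s) has_vector_derivative 1) (at 0)"
    using has_vector_derivative_add[OF has_vector_derivative_const[of z "at 0"] 
        has_vector_derivative_of_real[OF DERIV_ident]]
    by (simp only: add_0_left mult_1_right of_real_1)
  from has_vector_derivative_compose[OF this, of F F'] assms
  have "((\<lambda>s. F (z + of_real s)) has_vector_derivative F' 1) (at 0)"
    by simp
  then show ?thesis
    by (simp add: stem_dalpha_def vector_derivative_at)
qed

lemma stem_dbeta_eq: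
  assumes "(F has_derivative F') (at z)"
  shows "stem_dbeta F z = F' \<i>"
proof -
  have "((\<lambda>s. z + \<i> * of_real s) has_vector_derivative \<i>) (at 0)"
    using has_vector_derivative_add[OF has_vector_derivative_const[of z "at 0"] 
        has_vector_derivative_mult_right[OF has_vector_derivative_of_real[OF DERIV_ident], of \<i>]]
    by (simp only: add_0_left mult_1_right of_real_1)
  from has_vector_derivative_compose[OF this, of F F'] assms
  have "((\<lambda>s. F (z + \<i> * of_real s)) has_vector_derivative F' \<i>) (at 0)"
    by simp
  then show ?thesis
    by (simp add: stem_dbeta_def vector_derivative_at)
qed

lemma bounded_linear_cplx_bar: "bounded_linear cplx_bar"
  unfolding cplx_bar_def
  by (intro bounded_linear_Pair bounded_linear_fst bounded_linear_minus bounded_linear_snd)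

lemma cplx_bar_cplx_bar [simp]: "cplx_bar (cplx_bar w) = w"
  by (simp add: cplx_bar_def)

lemma stem_has_derivative_cnj:
  assumes D: "open D" "\<And>z. z \<in> D \<Longrightarrow> cnj z \<in> D" and F: "stem_function D F" and z: "z \<in> D"
    and F': "(F has_derivative F') (at z)"
  shows "(F has_derivative (\<lambda>w. cplx_bar (F' (cnj w)))) (at (cnj z))"
proof -
  have "((\<lambda>w. F (cnj w)) has_derivative (\<lambda>w. F' (cnj w))) (at (cnj z))"
    using has_derivative_compose[of cnj cnj "cnj z" UNIV F F'] F'
      bounded_linear_imp_has_derivative[OF bounded_linear_cnj] by simp
  then have "((\<lambda>w. cplx_bar (F (cnj w))) has_derivative (\<lambda>w. cplx_bar (F' (cnj w)))) (at (cnj z))"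
    by (rule bounded_linear.has_derivative[OF bounded_linear_cplx_bar])
  then show ?thesis
    by (rule has_derivative_transform_within_open[OF _ D(1) D(2)[OF z]])
      (use F D(2) in \<open>simp add: stem_function_def\<close>)
qed

section \<open>Recovering the stem function from the slice through \<open>v 1\<close>\<close>

context orthonormal_frame
begin

lemma induced_at:
  assumes "x \<in> M" "F (cnj (pt x)) = cplx_bar (F (pt x))"
  shows "induced F x = fst (F (pt x)) + unit x * snd (F (pt x))"
  using induced_eq[OF unit_imag_unit[of x], of F "Re (pt x)" "Im (pt x)"] M_polar[OF assms(1)] assms(2)
  by (simp add: complex_eq_iff cnj.code)

lemma stem_value:
  assumes "\<And>z. z \<in> D \<Longrightarrow> cnj z \<in> D" "stem_of_on D M f F" "x \<in> M" "pt x \<in> D"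
  shows "f x = fst (F (pt x)) + unit x * snd (F (pt x))"
  using assms induced_at[of x F] axial_set_iff[of D x] by (auto simp: stem_of_on_def stem_function_def)

lemma slice_point_in:
  assumes "z \<in> D" "s = 1 \<or> s = -1"
  shows "Re z *\<^sub>R 1 + (s * Im z) *\<^sub>R v 1 \<in> axial_set D \<inter> M"
proof
  have "Re z *\<^sub>R 1 + (s * Im z) *\<^sub>R v 1 = Re z *\<^sub>R 1 + Im z *\<^sub>R (s *\<^sub>R v 1)"
    by (simp add: mult.commute)
  moreover have "s *\<^sub>R v 1 \<in> imag_units"
    using v_imag_unit[of 1] uminus_imag_units[OF v_imag_unit[of 1]] m_pos assms(2) by auto
  moreover have "Complex (Re z) (Im z) \<in> D"
    using assms(1) by simp
  ultimately show "Re z *\<^sub>R 1 + (s * Im z) *\<^sub>R v 1 \<in> axial_set D"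
    unfolding axial_set_def by blast
  show "Re z *\<^sub>R 1 + (s * Im z) *\<^sub>R v 1 \<in> M"
    by (intro span_add span_scale one_in_M v_in_M m_pos)
qed

text \<open>The values at \<alpha> + \<beta> \<open>v 1\<close> and \<alpha> - \<beta>
  \<open>v 1\<close> are the sum and the difference of \<open>F_1\<close> and \<open>v 1\<close>
  times \<open>F_2\<close>; the second component is isolated by multiplying once more by
  \<open>v 1\<close>. Uniqueness and smoothness of the stem function both follow from this.\<close>

lemma stem_formula:
  assumes D: "\<And>z. z \<in> D \<Longrightarrow> cnj z \<in> D" and F: "stem_of_on D M f F" and z: "z \<in> D"
  shows "F z = ((1/2) *\<^sub>R (f (Re z *\<^sub>R 1 + Im z *\<^sub>R v 1) + f (Re z *\<^sub>R 1 - Im z *\<^sub>R v 1)),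
    - ((1/2) *\<^sub>R (v 1 * (f (Re z *\<^sub>R 1 + Im z *\<^sub>R v 1) - f (Re z *\<^sub>R 1 - Im z *\<^sub>R v 1)))))"
proof -
  have v1: "v 1 \<in> imag_units"
    using v_imag_unit m_pos by simp
  have bar: "F (Complex (Re z) (- Im z)) = cplx_bar (F (Complex (Re z) (Im z)))"
    using F z by (simp add: stem_of_on_def stem_function_def flip: cnj.code)
  have 1: "f (Re z *\<^sub>R 1 + Im z *\<^sub>R v 1) = fst (F z) + v 1 * snd (F z)"
    using F slice_point_in[OF z, of 1] induced_eq[OF v1 bar] by (simp add: stem_of_on_def)
  have 2: "f (Re z *\<^sub>R 1 - Im z *\<^sub>R v 1) = fst (F z) - v 1 * snd (F z)"
    using F slice_point_in[OF z, of "-1"] induced_eq[OF uminus_imag_units[OF v1] bar]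
    by (simp add: stem_of_on_def alg.minus_left)
  have "v 1 * (v 1 * snd (F z)) = - snd (F z)"
    by (rule imag_unitsD(3)[OF v1])
  then have "v 1 * (v 1 * snd (F z) + v 1 * snd (F z)) = (- 2) *\<^sub>R snd (F z)"
    by (simp add: alg.add_right scaleR_2)
  then show ?thesis
    unfolding 1 2 by (simp add: prod_eq_iff)
qed

lemma stem_unique:
  assumes "\<And>z. z \<in> D \<Longrightarrow> cnj z \<in> D" "stem_of_on D M f F" "stem_of_on D M f G" "z \<in> D"
  shows "F z = G z"
  using stem_formula[OF assms(1,2,4)] stem_formula[OF assms(1,3,4)] by simp

text \<open>The slice is parametrized by the linear maps \<open>\<phi> 1\<close> and
  \<open>\<phi> (-1)\<close>, which send D into \<Omega>. Hence derivatives within \<Omega>, which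
  say nothing about directions outside M, are enough for ordinary derivatives of F on the open set
  D.\<close>

lemma stem_C1:
  assumes D: "open D" "\<And>z. z \<in> D \<Longrightarrow> cnj z \<in> D" and F: "stem_of_on D M f F"
    and f: "C1_on (axial_set D \<inter> M) f"
  obtains F' where "\<And>z. z \<in> D \<Longrightarrow> (F has_derivative F' z) (at z)"
    "\<And>w. continuous_on D (\<lambda>z. F' z w)"
proof -
  obtain f' where f': "\<And>x. x \<in> axial_set D \<inter> M \<Longrightarrow>
      (f has_derivative blinfun_apply (f' x)) (at x within (axial_set D \<inter> M))"
    and cont: "continuous_on (axial_set D \<inter> M) f'"
    using f by (auto simp: C1_on_def)
  define \<phi> where "\<phi> s z = Re z *\<^sub>R 1 + (s * Im z) *\<^sub>R v 1" for s z
  have lin: "bounded_linear (\<phi> s)" for s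
    unfolding \<phi>_def
    by (intro bounded_linear_add bounded_linear_scaleR_left[THEN bounded_linear_compose]
        bounded_linear_mult_right[THEN bounded_linear_compose] bounded_linear_Re bounded_linear_Im)
  have sub: "\<phi> s ` D \<subseteq> axial_set D \<inter> M" if "s = 1 \<or> s = -1" for s
    using slice_point_in that by (auto simp: \<phi>_def)
  have der: "((\<lambda>z. f (\<phi> s z)) has_derivative (\<lambda>w. blinfun_apply (f' (\<phi> s z)) (\<phi> s w))) (at z)"
    if "z \<in> D" "s = 1 \<or> s = -1" for s z
  proof -
    have "((\<lambda>z. f (\<phi> s z)) has_derivative (\<lambda>w. blinfun_apply (f' (\<phi> s z)) (\<phi> s w))) (at z within D)"
      using that sub[OF that(2)]
      by (intro has_derivative_in_compose[OF bounded_linear_imp_has_derivative[OF lin]]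
          has_derivative_subset[OF f']) auto
    then show ?thesis
      by (simp only: at_within_open[OF that(1) D(1)])
  qed
  have cont': "continuous_on D (\<lambda>z. blinfun_apply (f' (\<phi> s z)) (\<phi> s w))" if "s = 1 \<or> s = -1" for s w
    by (intro continuous_intros continuous_on_compose2[OF cont] linear_continuous_on lin sub that)
  define F' where "F' z w = ((1/2) *\<^sub>R (blinfun_apply (f' (\<phi> 1 z)) (\<phi> 1 w) + blinfun_apply (f' (\<phi> (-1) z)) (\<phi> (-1) w)),
      - ((1/2) *\<^sub>R (v 1 * (blinfun_apply (f' (\<phi> 1 z)) (\<phi> 1 w) - blinfun_apply (f' (\<phi> (-1) z)) (\<phi> (-1) w)))))"
    for z w
  have "(F has_derivative F' z) (at z)" if "z \<in> D" for z
  proof -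
    have "((\<lambda>z. ((1/2) *\<^sub>R (f (\<phi> 1 z) + f (\<phi> (-1) z)),
        - ((1/2) *\<^sub>R (v 1 * (f (\<phi> 1 z) - f (\<phi> (-1) z)))))) has_derivative F' z) (at z)"
      unfolding F'_def
      by (intro has_derivative_Pair has_derivative_scaleR_right has_derivative_minus
          bounded_linear.has_derivative[OF alg.bounded_linear_right]
          has_derivative_add has_derivative_diff der that) auto
    then show ?thesis
      by (rule has_derivative_transform_within_open[OF _ D(1) that])
        (use stem_formula[OF D(2) F] in \<open>simp add: \<phi>_def\<close>)
  qed
  moreover have "continuous_on D (\<lambda>z. F' z w)" for w
    unfolding F'_def
    by (intro continuous_intros cont' bounded_linear.continuous_on[OF alg.bounded_linear_right]) auto
  ultimately show thesis
    by (rule that)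
qed

text \<open>Eliminates the choice operator: the chosen stem function agrees with K on the open set D
  and so has the same derivatives. The two conjugation identities are what evaluating
  \<open>induced\<close> requires.\<close>

lemma stem_dz_at_slice:
  assumes D: "open D" "\<And>z. z \<in> D \<Longrightarrow> cnj z \<in> D" and K: "stem_of_on D M g K"
    and z: "z \<in> D" and K': "(K has_derivative K') (at z)"
  defines "K0 \<equiv> SOME K. stem_of_on D M g K"
  shows "stem_dz K0 z = (1/2) *\<^sub>R (K' 1 - iota_mult (K' \<i>))"
    and "stem_dzbar K0 z = (1/2) *\<^sub>R (K' 1 + iota_mult (K' \<i>))"
    and "stem_dz K0 (cnj z) = cplx_bar (stem_dz K0 z)"
    and "stem_dzbar K0 (cnj z) = cplx_bar (stem_dzbar K0 z)"
proof -
  have K0: "stem_of_on D M g K0"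
    unfolding K0_def by (rule someI[of _ K]) (rule K)
  have 1: "(K0 has_derivative K') (at z)"
    by (rule has_derivative_transform_within_open[OF K' D(1) z]) (rule stem_unique[OF D(2) K K0])
  have 2: "(K0 has_derivative (\<lambda>w. cplx_bar (K' (cnj w)))) (at (cnj z))"
    by (rule stem_has_derivative_cnj[OF D K0[unfolded stem_of_on_def, THEN conjunct1] z 1])
  have neg: "K' (- \<i>) = - K' \<i>"
    by (rule linear_neg[OF has_derivative_linear[OF K']])
  show "stem_dz K0 z = (1/2) *\<^sub>R (K' 1 - iota_mult (K' \<i>))"
    "stem_dzbar K0 z = (1/2) *\<^sub>R (K' 1 + iota_mult (K' \<i>))"
    using 1 by (simp_all add: stem_dz_def stem_dzbar_def stem_dalpha_eq stem_dbeta_eq)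
  then show "stem_dz K0 (cnj z) = cplx_bar (stem_dz K0 z)"
    "stem_dzbar K0 (cnj z) = cplx_bar (stem_dzbar K0 z)"
    using 2 by (simp_all add: stem_dz_def stem_dzbar_def stem_dalpha_eq stem_dbeta_eq neg cplx_bar_def
        iota_mult_def scaleR_add_right scaleR_diff_right)
qed

lemma slice_dx_at:
  assumes "open D" "\<And>z. z \<in> D \<Longrightarrow> cnj z \<in> D" "stem_of_on D M g K"
    and "x \<in> M" "pt x \<in> D" "(K has_derivative K') (at (pt x))"
  shows "slice_dx D M g x =
      (1/2) *\<^sub>R (fst (K' 1) + snd (K' \<i>) + unit x * (snd (K' 1) - fst (K' \<i>)))"
    and "slice_dxc D M g x =
      (1/2) *\<^sub>R (fst (K' 1) - snd (K' \<i>) + unit x * (snd (K' 1) + fst (K' \<i>)))"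
  using stem_dz_at_slice[OF assms(1-3,5,6)] assms(4)
  by (simp_all add: slice_dx_def slice_dxc_def induced_at iota_mult_def alg_scaleR_right
      flip: scaleR_add_right scaleR_diff_right)

lemma pt_has_vector_derivative:
  assumes "i \<le> m" "N x \<noteq> 0"
  shows "((\<lambda>s. pt (x + s *\<^sub>R v i)) has_vector_derivative
    (if i = 0 then 1 else (X i x / N x) *\<^sub>R \<i>)) (at 0)"
proof -
  have X: "((\<lambda>s. X j (x + s *\<^sub>R v i)) has_real_derivative X j (v i)) (at 0)" for j
    unfolding X_simps by (auto intro!: derivative_eq_intros)
  have pos: "0 < (\<Sum>j=1..m. (X j x)\<^sup>2)"
    using assms(2) N_ge_0[of x] by (simp add: N_def less_le)
  have "((\<lambda>s. N (x + s *\<^sub>R v i)) has_real_derivative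
      (\<Sum>j=1..m. 2 * X j x * X j (v i)) / (2 * N x)) (at 0)"
    unfolding N_def
    by (rule derivative_eq_intros X refl | use pos in \<open>simp add: field_simps\<close>)+
  moreover have "(\<Sum>j=1..m. 2 * X j x * X j (v i)) = (if i = 0 then 0 else 2 * X i x)"
  proof -
    have "(\<Sum>j=1..m. 2 * X j x * X j (v i)) = (\<Sum>j=1..m. if j = i then 2 * X i x else 0)"
      using assms(1) by (intro sum.cong refl) (auto simp: X_v)
    then show ?thesis
      using assms(1) by auto
  qed
  ultimately have N: "((\<lambda>s. N (x + s *\<^sub>R v i)) has_vector_derivative (if i = 0 then 0 else X i x / N x)) (at 0)"
    by (auto simp: has_real_derivative_iff_has_vector_derivative split: if_splits)
  have "((\<lambda>s. complex_of_real (X 0 (x + s *\<^sub>R v i)) + \<i> * complex_of_real (N (x + s *\<^sub>R v i)))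
      has_vector_derivative (if i = 0 then 1 else (X i x / N x) *\<^sub>R \<i>)) (at 0)"
    using X[of 0] N assms(1)
    by (auto intro!: derivative_eq_intros bounded_linear.has_vector_derivative[OF bounded_linear_of_real]
        simp: has_real_derivative_iff_has_vector_derivative X_v scaleR_conv_of_real)
  then show ?thesis
    by (simp add: pt_def Complex_eq)
qed

lemma pt_line_open:
  assumes "open D"
  shows "open {s. pt (x + s *\<^sub>R v i) \<in> D}"
proof -
  have "continuous_on UNIV (\<lambda>s. pt (x + s *\<^sub>R v i))"
    by (intro continuous_on_compose2[OF continuous_on_pt[of UNIV]] continuous_intros) auto
  from open_vimage[OF assms this] show ?thesis
    by (simp add: vimage_def)
qed

end

subsection \<open>Differential operators on axially symmetric functions\<close>

text \<open>A real point of D is the limit of the nonreal points of D above and below it on a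
  vertical line.\<close>

lemma continuous_zero_off_reals:
  fixes \<Phi> :: "complex \<Rightarrow> 'b::t2_space"
  assumes "open D" "continuous_on D \<Phi>" "\<And>z. z \<in> D - \<real> \<Longrightarrow> \<Phi> z = c" "z \<in> D"
  shows "\<Phi> z = c"
proof (cases "z \<in> \<real>")
  case True
  have line: "continuous_on UNIV (\<lambda>s. z + \<i> * of_real s)"
    by (intro continuous_intros)
  have lim: "((\<lambda>s. z + \<i> * of_real s) \<longlongrightarrow> z) (at 0)"
    using line by (simp add: continuous_on_eq_continuous_at isCont_def) (metis mult_zero_right of_real_0 add_0_right)
  have "isCont \<Phi> z"
    using assms by (simp add: continuous_on_eq_continuous_at)
  then have "((\<lambda>s. \<Phi> (z + \<i> * of_real s)) \<longlongrightarrow> \<Phi> z) (at 0)"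
    using lim by (rule isCont_tendsto_compose)
  moreover have "eventually (\<lambda>s. \<Phi> (z + \<i> * of_real s) = c) (at 0)"
    using topological_tendstoD[OF lim assms(1,4)] eventually_neq_at_within[of 0 0 UNIV]
    by eventually_elim (use True assms(3) in \<open>auto simp: complex_is_Real_iff\<close>)
  ultimately have "((\<lambda>s::real. c) \<longlongrightarrow> \<Phi> z) (at 0)"
    by (simp add: tendsto_cong)
  then show ?thesis
    using tendsto_unique[OF _ _ tendsto_const] at_neq_bot by blast
qed (use assms in auto)

context orthonormal_frame
begin

lemma line_in_M: "x \<in> M \<Longrightarrow> i \<le> m \<Longrightarrow> x + s *\<^sub>R v i \<in> M"
  by (intro span_add span_scale v_in_M)

lemma continuous_zero_off_real_line:
  fixes g :: "'a \<Rightarrow> 'b::t2_space"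
  assumes "open D" "continuous_on {x \<in> M. pt x \<in> D} g" "x \<in> M" "pt x \<in> D"
    and "\<And>x. x \<in> M \<Longrightarrow> pt x \<in> D \<Longrightarrow> N x \<noteq> 0 \<Longrightarrow> g x = c"
  shows "g x = c"
proof (cases "N x = 0")
  case True
  define S where "S = {s. pt (x + s *\<^sub>R v 1) \<in> D}"
  have S: "open S" "0 \<in> S"
    using assms(4) unfolding S_def by (auto intro: pt_line_open[OF assms(1)])
  have "continuous_on S (\<lambda>s. g (x + s *\<^sub>R v 1))"
    by (intro continuous_on_compose2[OF assms(2)] continuous_intros)
      (use assms(3) m_pos in \<open>auto simp: S_def intro!: line_in_M\<close>)
  then have "isCont (\<lambda>s. g (x + s *\<^sub>R v 1)) 0"
    using S by (simp add: continuous_on_eq_continuous_at)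
  then have "((\<lambda>s. g (x + s *\<^sub>R v 1)) \<longlongrightarrow> g x) (at 0)"
    by (simp add: isCont_def)
  moreover have "eventually (\<lambda>s. g (x + s *\<^sub>R v 1) = c) (at 0)"
    using eventually_at_in_open'[OF S] eventually_neq_at_within[of 0 0 UNIV]
  proof eventually_elim
    case (elim s)
    have "X 1 (x + s *\<^sub>R v 1) = s"
      using N_eq_0[OF True, of 1] m_pos by (simp add: X_simps X_v)
    then have "N (x + s *\<^sub>R v 1) \<noteq> 0"
      using N_eq_0[of "x + s *\<^sub>R v 1" 1] m_pos elim by auto
    then show ?case
      using elim by (intro assms(5) line_in_M assms(3) m_pos) (auto simp: S_def)
  qed
  ultimately have "((\<lambda>s::real. c) \<longlongrightarrow> g x) (at 0)"
    by (simp add: tendsto_cong)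
  then show ?thesis
    using tendsto_unique[OF _ _ tendsto_const] at_neq_bot by blast
qed (use assms in auto)

lemma axial_line_has_vector_derivative:
  assumes "N x \<noteq> 0" "i \<le> m" "(A has_derivative A') (at (pt x))" "(B has_derivative B') (at (pt x))"
  shows "((\<lambda>s. A (pt (x + s *\<^sub>R v i)) + V (x + s *\<^sub>R v i) * B (pt (x + s *\<^sub>R v i))) has_vector_derivative
    (if i = 0 then A' 1 + V x * B' 1
     else (X i x / N x) *\<^sub>R (A' \<i> + V x * B' \<i>) + v i * B (pt x))) (at 0)"
proof -
  define w where "w = (if i = 0 then 1 else (X i x / N x) *\<^sub>R \<i>)"
  have pt: "((\<lambda>s. pt (x + s *\<^sub>R v i)) has_vector_derivative w) (at 0)"
    unfolding w_def by (rule pt_has_vector_derivative) fact+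
  have AB: "((\<lambda>s. A (pt (x + s *\<^sub>R v i))) has_vector_derivative A' w) (at 0)"
    "((\<lambda>s. B (pt (x + s *\<^sub>R v i))) has_vector_derivative B' w) (at 0)"
    using has_vector_derivative_compose[OF pt, of A A'] has_vector_derivative_compose[OF pt, of B B']
      assms(3,4) by simp_all
  have "((\<lambda>s. V (x + s *\<^sub>R v i)) has_vector_derivative V (v i)) (at 0)"
    unfolding V_simps
    using has_vector_derivative_add[OF has_vector_derivative_const[of "V x" "at 0"]
        has_vector_derivative_scaleR[OF DERIV_ident has_vector_derivative_const[of "V (v i)"], of 0 UNIV]]
    by simp
  from has_vector_derivative_add[OF AB(1) alg.has_vector_derivative[OF this AB(2)]]
  have "((\<lambda>s. A (pt (x + s *\<^sub>R v i)) + V (x + s *\<^sub>R v i) * B (pt (x + s *\<^sub>R v i))) has_vector_derivative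
      A' w + (V x * B' w + V (v i) * B (pt x))) (at 0)"
    by simp
  moreover have "A' (r *\<^sub>R \<i>) = r *\<^sub>R A' \<i>" "B' (r *\<^sub>R \<i>) = r *\<^sub>R B' \<i>" for r
    using assms(3,4) by (simp_all only: linear_scale[OF has_derivative_linear])
  ultimately show ?thesis
    using V_v[OF assms(2)]
    by (auto simp: w_def alg_scaleR_right alg.zero_left scaleR_add_right simp del: of_real_mult
        intro: back_subst[of "\<lambda>d. (_ has_vector_derivative d) _"])
qed

lemma pderiv_line_cong:
  assumes "open D" "x \<in> M" "pt x \<in> D" "i \<le> m" "\<And>y. y \<in> M \<Longrightarrow> pt y \<in> D \<Longrightarrow> g y = h y"
    and "((\<lambda>s. h (x + s *\<^sub>R v i)) has_vector_derivative d) (at 0)"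
  shows "pderiv_dir v i g x = d"
proof -
  have "((\<lambda>s. g (x + s *\<^sub>R v i)) has_vector_derivative d) (at 0)"
    by (rule has_vector_derivative_transform_within_open[OF assms(6) pt_line_open[OF assms(1), of x i]])
      (use assms in \<open>auto simp: line_in_M\<close>)
  then show ?thesis
    by (simp add: pderiv_dir_def vector_derivative_at)
qed

lemma sum_v_mult:
  assumes "N x \<noteq> 0"
  shows "(\<Sum>i=1..m. v i * ((X i x / N x) *\<^sub>R y)) = unit x * y"
  using assms by (simp add: unit_def V_def alg_scaleR_left alg_scaleR_right alg.sum_left scaleR_sum_right)

lemma unit_V: "N x \<noteq> 0 \<Longrightarrow> unit x * (V x * y) = - (N x *\<^sub>R y)"
  using V_V[of x y] by (simp add: unit_def alg_scaleR_left power2_eq_square)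

context
  fixes D g A B A' B' x
  assumes D: "open D" "x \<in> M" "pt x \<in> D" "N x \<noteq> 0"
    and g: "\<And>y. y \<in> M \<Longrightarrow> pt y \<in> D \<Longrightarrow> g y = A (pt y) + V y * B (pt y)"
    and A': "(A has_derivative A') (at (pt x))" and B': "(B has_derivative B') (at (pt x))"
begin

lemma pderiv_axial:
  assumes "i \<le> m"
  shows "pderiv_dir v i g x = (if i = 0 then A' 1 + V x * B' 1
     else (X i x / N x) *\<^sub>R (A' \<i> + V x * B' \<i>) + v i * B (pt x))"
  by (rule pderiv_line_cong[OF D(1,2,3) assms g axial_line_has_vector_derivative[OF D(4) assms A' B']])

text \<open>The radial parts carry the weights \<open>X i x / N x\<close> and assemble to left
  multiplication by \<open>unit x\<close>, which turns \<open>V x\<close> into \<open>- N x\<close>.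
  Differentiating \<open>V x\<close> itself leaves \<open>v i\<close> applied twice to B, that is
  \<open>- B\<close>, once per direction.\<close>

lemma dirac_axial:
  "(\<Sum>i=1..m. v i * pderiv_dir v i g x) = unit x * A' \<i> - N x *\<^sub>R B' \<i> - real m *\<^sub>R B (pt x)"
proof -
  have "(\<Sum>i=1..m. v i * pderiv_dir v i g x) =
      (\<Sum>i=1..m. v i * ((X i x / N x) *\<^sub>R (A' \<i> + V x * B' \<i>)) - B (pt x))"
    by (intro sum.cong refl) (simp add: pderiv_axial alg.add_right v_v)
  also have "\<dots> = unit x * (A' \<i> + V x * B' \<i>) - real m *\<^sub>R B (pt x)"
    by (simp only: sum_subtractf sum_v_mult[OF D(4)]) (simp add: scaleR_conv_of_real sum_constant_scaleR)
  finally show ?thesis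
    by (simp add: alg.add_right unit_V[OF D(4)])
qed

text \<open>The operators \<open>L_op\<close> are tangential to spheres, so they see
  \<open>V x\<close> but not A and B. The Clifford relations then give two sums equal to
  \<open>- m V x B\<close> and a diagonal correction of \<open>2 V x B\<close>, which together
  produce the factor m - 1.\<close>

lemma Gamma_axial: "Gamma_op v m g x = (real m - 1) *\<^sub>R (V x * B (pt x))"
proof -
  let ?b = "B (pt x)"
  have vvv: "v i * (v j * (v i * ?b)) = v j * ?b - (if i = j then 2 else 0) *\<^sub>R (v i * ?b)"
    if "i \<in> {1..m}" "j \<in> {1..m}" for i j
    using that by (subst v_clifford) (simp_all add: v_v alg.minus_right)
  have inner: "v i * (v j * L_op v m i j g x) = - (X i x *\<^sub>R (v i * ?b)) - X j x *\<^sub>R (v j * ?b)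
      + (if i = j then (2 * X i x) *\<^sub>R (v i * ?b) else 0)" if "i \<in> {1..m}" "j \<in> {1..m}" for i j
  proof -
    \<comment> \<open>The radial part of the derivative in direction i is proportional to
      \<open>X i x\<close>, so the two radial terms cancel by antisymmetry.\<close>
    have "L_op v m i j g x = X i x *\<^sub>R (v j * ?b) - X j x *\<^sub>R (v i * ?b)"
      using that D(2) by (simp add: L_op_def coord_eq pderiv_axial scaleR_add_right mult.commute)
    then have "v i * (v j * L_op v m i j g x) =
        X i x *\<^sub>R (v i * (v j * (v j * ?b))) - X j x *\<^sub>R (v i * (v j * (v i * ?b)))"
      by (simp add: alg.diff_right alg_scaleR_right)
    also have "\<dots> = - (X i x *\<^sub>R (v i * ?b)) - X j x *\<^sub>R (v j * ?b - (if i = j then 2 else 0) *\<^sub>R (v i * ?b))"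
      by (simp only: vvv[OF that] v_v[OF that(2)] alg.minus_right scaleR_minus_right)
    finally show ?thesis
      by (simp add: scaleR_diff_right mult.commute)
  qed
  have V: "(\<Sum>i=1..m. X i x *\<^sub>R (v i * ?b)) = V x * ?b"
    by (simp add: V_def alg.sum_left alg_scaleR_left)
  have "(\<Sum>i=1..m. \<Sum>j=1..m. v i * (v j * L_op v m i j g x)) =
     (\<Sum>i=1..m. \<Sum>j=1..m. - (X i x *\<^sub>R (v i * ?b)) - X j x *\<^sub>R (v j * ?b)
      + (if i = j then (2 * X i x) *\<^sub>R (v i * ?b) else 0))"
    by (intro sum.cong refl inner)
  also have "\<dots> = (\<Sum>i=1..m. - (real m *\<^sub>R (X i x *\<^sub>R (v i * ?b))) - V x * ?b + 2 *\<^sub>R (X i x *\<^sub>R (v i * ?b)))"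
    by (intro sum.cong refl) (simp add: sum.distrib sum_subtractf V[simplified] sum_constant_scaleR)
  also have "\<dots> = - (real m *\<^sub>R (V x * ?b)) - real m *\<^sub>R (V x * ?b) + 2 *\<^sub>R (V x * ?b)"
    by (simp only: sum.distrib sum_subtractf sum_negf V flip: scaleR_sum_right) (simp add: sum_constant_scaleR)
  also have "\<dots> = (- 2 * (real m - 1)) *\<^sub>R (V x * ?b)"
    by (simp add: algebra_simps flip: scaleR_add_left)
  finally have "Gamma_op v m g x = - ((1/2) *\<^sub>R ((- 2 * (real m - 1)) *\<^sub>R (V x * ?b)))"
    by (simp only: Gamma_op_def)
  also have "\<dots> = (- (1/2 * (- 2 * (real m - 1)))) *\<^sub>R (V x * ?b)"
    by (simp only: scaleR_scaleR scaleR_minus_left)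
  also have "- (1/2 * (- 2 * (real m - 1))) = real m - 1"
    by (simp add: field_simps)
  finally show ?thesis .
qed

end

end

subsection \<open>Slice functions\<close>

context orthonormal_frame
begin

lemma unit_aconj: "x \<in> M \<Longrightarrow> N x \<noteq> 0 \<Longrightarrow> unit (aconj x) = - unit x"
  using pt_aconj[of x] by (simp add: unit_def V_aconj pt_def)

text \<open>Passing from x to its conjugate keeps \<open>pt x\<close> and negates
  \<open>unit x\<close>; the sum of the two equations kills the first component, and invertibility
  of the unit kills the second. No continuity is assumed, so this also applies to \<open>G'\<close>,
  whose formula divides by \<open>Im z\<close>.\<close>

lemma stem_zero_of_slice_zero:
  assumes zero: "\<And>x. x \<in> M \<Longrightarrow> pt x \<in> D \<Longrightarrow> N x \<noteq> 0 \<Longrightarrow>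
      fst (\<Phi> (pt x)) + unit x * snd (\<Phi> (pt x)) = 0"
    and z: "z \<in> D" "0 < Im z"
  shows "\<Phi> z = 0"
proof -
  define x where "x = Re z *\<^sub>R 1 + Im z *\<^sub>R v 1"
  have pt: "pt x = z"
    using pt_polar[of 1 "Im z" "Re z"] m_pos z by (simp add: x_def)
  have x: "x \<in> M"
    unfolding x_def by (intro span_add span_scale one_in_M v_in_M m_pos)
  have "N x \<noteq> 0"
    using arg_cong[OF pt, of Im] z by (simp add: pt_def)
  note x = x this
  have N': "N (aconj x) \<noteq> 0"
    using pt_aconj[OF x(1)] x by (simp add: pt_def)
  have 1: "fst (\<Phi> z) + unit x * snd (\<Phi> z) = 0"
    using zero[of x] x pt z by simp
  have 2: "fst (\<Phi> z) - unit x * snd (\<Phi> z) = 0"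
    using zero[of "aconj x"] x N' z unit_aconj[OF x] aconj_in_M[OF x(1)] pt pt_aconj[OF x(1)]
    by (simp add: alg.minus_left)
  from 1 2 have "fst (\<Phi> z) + fst (\<Phi> z) = 0"
    by (metis add.assoc add_diff_cancel_left' diff_0_right diff_add_cancel diff_diff_eq2)
  then have fst: "fst (\<Phi> z) = 0"
    by (simp flip: scaleR_2)
  with 1 have "unit x * (unit x * snd (\<Phi> z)) = 0"
    by (simp add: alg.zero_right)
  then have "snd (\<Phi> z) = 0"
    by (simp add: imag_unitsD(3)[OF unit_imag_unit])
  with fst show ?thesis
    by (simp add: prod_eq_iff)
qed

text \<open>Symmetry under conjugation covers the lower half-plane, continuity the real axis.\<close>
lemma stem_zero_of_slice_zero':
  assumes "open D" and cnj: "\<And>z. z \<in> D \<Longrightarrow> cnj z \<in> D" and cont: "continuous_on D \<Phi>"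
    and stem: "stem_function D \<Phi>"
    and zero: "\<And>x. x \<in> M \<Longrightarrow> pt x \<in> D \<Longrightarrow> N x \<noteq> 0 \<Longrightarrow>
      fst (\<Phi> (pt x)) + unit x * snd (\<Phi> (pt x)) = 0"
    and "z \<in> D"
  shows "\<Phi> z = 0"
proof (rule continuous_zero_off_reals[OF assms(1) cont _ \<open>z \<in> D\<close>])
  fix z assume z: "z \<in> D - \<real>"
  then have "0 < Im z \<or> 0 < Im (cnj z)"
    by (auto simp: complex_is_Real_iff)
  then show "\<Phi> z = 0"
  proof
    assume "0 < Im z"
    with z show ?thesis
      using stem_zero_of_slice_zero[OF zero] by auto
  next
    assume *: "0 < Im (cnj z)"
    with z have "\<Phi> (cnj z) = 0"
      using stem_zero_of_slice_zero[OF zero _ *] cnj by auto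
    moreover have "\<Phi> (cnj z) = cplx_bar (\<Phi> z)"
      using stem z by (auto simp: stem_function_def)
    ultimately show ?thesis
      by (simp add: cplx_bar_def prod_eq_iff)
  qed
qed

end

section \<open>First-order operators on a slice function with differentiable stem function\<close>

locale slice_stem = orthonormal_frame v m
  for v :: "nat \<Rightarrow> 'a::alternative_star_algebra" and m +
  fixes D :: "complex set" and f :: "'a \<Rightarrow> 'a" and F :: "complex \<Rightarrow> 'a \<times> 'a"
    and F' :: "complex \<Rightarrow> complex \<Rightarrow> 'a \<times> 'a"
  assumes open_D: "open D" and cnj_D: "z \<in> D \<Longrightarrow> cnj z \<in> D"
    and stem: "stem_of_on D M f F"
    and F': "z \<in> D \<Longrightarrow> (F has_derivative F' z) (at z)"
begin

lemma stem_F: "stem_function D F"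
  using stem by (simp add: stem_of_on_def)

lemma stem_F': "z \<in> D \<Longrightarrow> F' (cnj z) w = cplx_bar (F' z (cnj w))"
  using has_derivative_unique[OF F'[OF cnj_D] stem_has_derivative_cnj[OF open_D cnj_D stem_F _ F']]
  by (auto simp: fun_eq_iff)

lemma F'_scaleR: "z \<in> D \<Longrightarrow> F' z (r *\<^sub>R w) = r *\<^sub>R F' z w"
  using linear_scale[OF has_derivative_linear[OF F']] .

lemma F'_minus: "z \<in> D \<Longrightarrow> F' z (- w) = - F' z w"
  using linear_neg[OF has_derivative_linear[OF F']] .

lemma F'_add: "z \<in> D \<Longrightarrow> F' z (w + w') = F' z w + F' z w'"
  using linear_add[OF has_derivative_linear[OF F']] .

lemma F'_expand:
  assumes "z \<in> D"
  shows "F' z w = Re w *\<^sub>R F' z 1 + Im w *\<^sub>R F' z \<i>"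
proof -
  have "w = Re w *\<^sub>R 1 + Im w *\<^sub>R \<i>"
    by (simp add: complex_eq_iff)
  then have "F' z w = F' z (Re w *\<^sub>R 1 + Im w *\<^sub>R \<i>)"
    by (rule arg_cong)
  then show ?thesis
    by (simp only: F'_add[OF assms] F'_scaleR[OF assms])
qed

definition G :: "complex \<Rightarrow> 'a"
  where "G z = (1 / Im z) *\<^sub>R snd (F z)"

definition G' :: "complex \<Rightarrow> complex \<Rightarrow> 'a"
  where "G' z w = (1 / Im z) *\<^sub>R snd (F' z w) - (Im w / (Im z)\<^sup>2) *\<^sub>R snd (F z)"

lemma G': 
  assumes "z \<in> D - \<real>"
  shows "(G has_derivative G' z) (at z)"
proof -
  have z: "z \<in> D" "Im z \<noteq> 0"
    using assms by (auto simp: complex_is_Real_iff)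
  have "((\<lambda>z. inverse (Im z)) has_derivative (\<lambda>w. - (Im w / (Im z)\<^sup>2))) (at z)"
    using z by (auto intro!: derivative_eq_intros simp: power2_eq_square field_simps)
  from has_derivative_scaleR[OF this has_derivative_snd[OF F'[OF z(1)]]]
  show ?thesis
    unfolding G_def[abs_def] G'_def[abs_def] by (simp add: divide_inverse algebra_simps)
qed

lemma value_M: "x \<in> M \<Longrightarrow> pt x \<in> D \<Longrightarrow> f x = fst (F (pt x)) + unit x * snd (F (pt x))"
  using stem_value[OF cnj_D stem] .

lemma value_axial:
  assumes "x \<in> M" "pt x \<in> D - \<real>"
  shows "f x = fst (F (pt x)) + V x * G (pt x)"
  using assms value_M[of x]
  by (simp add: pt_real_iff G_def unit_def alg_scaleR_left alg_scaleR_right) (simp add: pt_def)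

lemma spherical_deriv_at:
  assumes "x \<in> M" "pt x \<in> D - \<real>"
  shows "spherical_deriv f x = G (pt x)"
proof -
  have N: "N x \<noteq> 0"
    using assms(2) by (simp add: pt_real_iff)
  have "alg_Im x = N x *\<^sub>R unit x"
    using assms(1) by (simp add: alg_Im_M N_unit)
  then have inv: "alg_inverse (alg_Im x) = (- (1 / N x)) *\<^sub>R unit x"
    using alg_inverse_scaleR_imag_unit[OF unit_imag_unit N] by simp
  have "f x - f (aconj x) = 2 *\<^sub>R (unit x * snd (F (pt x)))"
    using assms value_M[of x] value_M[of "aconj x"] N
    by (simp add: aconj_in_M pt_aconj unit_aconj alg.minus_left scaleR_2)
  then show ?thesis
    by (simp add: spherical_deriv_def inv alg_scaleR_left alg_scaleR_right alg.minus_left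
        imag_unitsD(3)[OF unit_imag_unit] G_def) (simp add: pt_def)
qed

lemma open_D': "open (D - \<real>)"
  by (intro open_Diff open_D closed_complex_Reals)

context
  fixes x assumes x: "x \<in> M" "pt x \<in> D - \<real>"
begin

lemma N_neq_0: "N x \<noteq> 0"
  using x by (simp add: pt_real_iff)

lemmas axial = open_D' x(1) x(2) N_neq_0 value_axial

lemma pt_in_D: "pt x \<in> D"
  using x by simp

lemma V_G': "V x * G' (pt x) 1 = unit x * snd (F' (pt x) 1)"
  using N_neq_0
  by (simp add: G'_def unit_def alg_scaleR_left alg_scaleR_right) (simp add: pt_def)

text \<open>The term \<open>- G\<close> comes from differentiating \<open>1 / \<beta>\<close>; it
  accounts for the 1 in the coefficient \<open>1 - m\<close> of the Dirac sum.\<close>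

lemma N_G': "N x *\<^sub>R G' (pt x) \<i> = snd (F' (pt x) \<i>) - G (pt x)"
  using N_neq_0
  by (simp add: G'_def G_def scaleR_diff_right power2_eq_square pt_def)

lemma pderiv_0: "pderiv_dir v 0 f x = fst (F' (pt x) 1) + unit x * snd (F' (pt x) 1)"
  using pderiv_axial[OF axial(1-5) has_derivative_fst[OF F'[OF pt_in_D]] G'[OF x(2)], of 0]
  by (simp add: V_G')

lemma dirac: "(\<Sum>i=1..m. v i * pderiv_dir v i f x) =
    unit x * fst (F' (pt x) \<i>) - snd (F' (pt x) \<i>) + (1 - real m) *\<^sub>R G (pt x)"
  using dirac_axial[OF axial(1-5) has_derivative_fst[OF F'[OF pt_in_D]] G'[OF x(2)]]
  by (simp add: N_G' scaleR_diff_left)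

lemma slice_dxs:
  "slice_dx D M f x = (1/2) *\<^sub>R (fst (F' (pt x) 1) + snd (F' (pt x) \<i>)
     + unit x * (snd (F' (pt x) 1) - fst (F' (pt x) \<i>)))"
  "slice_dxc D M f x = (1/2) *\<^sub>R (fst (F' (pt x) 1) - snd (F' (pt x) \<i>)
     + unit x * (snd (F' (pt x) 1) + fst (F' (pt x) \<i>)))"
  using slice_dx_at[OF open_D cnj_D stem x(1) pt_in_D F'[OF pt_in_D]] by simp_all

lemma Gamma_slice: "Gamma_op v m f x = (real m - 1) *\<^sub>R (alg_Im x * spherical_deriv f x)"
  using Gamma_axial[OF axial(1-5) has_derivative_fst[OF F'[OF pt_in_D]] G'[OF x(2)]]
  by (simp add: spherical_deriv_at[OF x] x alg_Im_M)

lemma dbar_slice: "dbar_op v m f x = slice_dxc D M f x + ((1 - real m) / 2) *\<^sub>R spherical_deriv f x"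
  by (simp add: dbar_op_def dirac[simplified] pderiv_0 slice_dxs spherical_deriv_at[OF x] alg.add_right
      scaleR_add_right scaleR_diff_right)

lemma d_slice: "d_op v m f x = slice_dx D M f x - ((1 - real m) / 2) *\<^sub>R spherical_deriv f x"
  by (simp add: d_op_def dirac[simplified] pderiv_0 slice_dxs spherical_deriv_at[OF x] alg.diff_right
      scaleR_add_right scaleR_diff_right)

text \<open>\<open>F_2\<close> and \<beta> are both odd under conjugation, so G is even and (G, 0)
  is a stem function, with domain \<open>D - \<real>\<close> because of the division by
  \<beta>.\<close>

lemma slice_dx_spherical:
  "slice_dx (D - \<real>) M (spherical_deriv f) x =
     (1/2) *\<^sub>R (G' (pt x) 1 - unit x * G' (pt x) \<i>)"
proof -
  have cnj': "cnj z \<in> D - \<real>" if "z \<in> D - \<real>" for z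
    using that cnj_D by (auto simp: complex_is_Real_iff)
  define K where "K z = (G z, 0::'a)" for z
  have stem_K: "stem_function (D - \<real>) K"
    using stem_F by (auto simp: stem_function_def K_def cplx_bar_def G_def)
  have "stem_of_on (D - \<real>) M (spherical_deriv f) K"
    unfolding stem_of_on_def
  proof (intro conjI stem_K ballI)
    fix y assume "y \<in> axial_set (D - \<real>) \<inter> M"
    then have y: "y \<in> M" "pt y \<in> D - \<real>"
      using axial_set_iff[OF cnj'] by auto
    have "induced K y = G (pt y)"
      using induced_at[of y K] y stem_K by (simp add: K_def alg.zero_right stem_function_def)
    then show "spherical_deriv f y = induced K y"
      using spherical_deriv_at[OF y] by simp
  qed
  from slice_dx_at(1)[OF open_D' cnj' this x, of "\<lambda>w. (G' (pt x) w, 0)"]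
  show ?thesis
    using G'[OF x(2)] by (simp add: K_def[abs_def] has_derivative_Pair alg.minus_right)
qed

text \<open>The spherical derivative is axial with B = 0. The correction by \<open>c_m\<close> stems
  from B alone, hence it disappears here.\<close>

lemma d_spherical: "d_op v m (spherical_deriv f) x = slice_dx (D - \<real>) M (spherical_deriv f) x"
proof -
  have sph: "spherical_deriv f y = G (pt y) + V y * 0" if "y \<in> M" "pt y \<in> D - \<real>" for y
    using spherical_deriv_at[OF that] by (simp add: alg.zero_right)
  note axial' = axial(1-4) sph G'[OF x(2)] has_derivative_const[of 0 "at (pt x)"]
  show ?thesis
    using dirac_axial[OF axial'] pderiv_axial[OF axial', of 0]
    by (simp add: d_op_def slice_dx_spherical alg.zero_right)
qed

end

text \<open>By uniqueness, the existence of some holomorphic stem function is a condition on F. Real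
  linearity reduces it to one Cauchy-Riemann equation.\<close>

lemma slice_regular_iff:
  "slice_regular D M f \<longleftrightarrow> (\<forall>z\<in>D. F' z \<i> = iota_mult (F' z 1))"
proof
  assume "slice_regular D M f"
  then obtain K where K: "stem_of_on D M f K" "stem_holomorphic D K"
    by (auto simp: slice_regular_def)
  show "\<forall>z\<in>D. F' z \<i> = iota_mult (F' z 1)"
  proof
    fix z assume z: "z \<in> D"
    then obtain K' where K': "(K has_derivative K') (at z)" "\<And>w. K' (\<i> * w) = iota_mult (K' w)"
      using K(2) by (auto simp: stem_holomorphic_def)
    have "(F has_derivative K') (at z)"
      by (rule has_derivative_transform_within_open[OF K'(1) open_D z])
        (rule stem_unique[OF cnj_D K(1) stem])
    then have "F' z = K'"
      using F'[OF z] has_derivative_unique by blast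
    then show "F' z \<i> = iota_mult (F' z 1)"
      using K'(2)[of 1] by simp
  qed
next
  assume *: "\<forall>z\<in>D. F' z \<i> = iota_mult (F' z 1)"
  have "stem_holomorphic D F"
    unfolding stem_holomorphic_def
  proof (intro ballI exI conjI allI)
    fix z w assume z: "z \<in> D"
    show "(F has_derivative F' z) (at z)"
      by (rule F'[OF z])
    show "F' z (\<i> * w) = iota_mult (F' z w)"
      using * z F'_expand[OF z, of "\<i> * w"] F'_expand[OF z, of w]
      by (simp add: iota_mult_def prod_eq_iff)
  qed
  then show "slice_regular D M f"
    using stem by (auto simp: slice_regular_def)
qed

end

subsection \<open>Slice-regular functions and the Laplacian\<close>

text \<open>Splitting both components along a real basis of the algebra turns a stem function into a
  family of complex-valued functions, with \<open>\<iota>\<close> acting as \<open>\<i>\<close>.\<close>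
definition stem_of_components :: "('a \<Rightarrow> complex) \<Rightarrow> 'a \<times> 'a::alternative_star_algebra"
  where "stem_of_components c = ((\<Sum>e\<in>Basis. Re (c e) *\<^sub>R e), (\<Sum>e\<in>Basis. Im (c e) *\<^sub>R e))"

lemma stem_of_components_mult:
  "stem_of_components (\<lambda>e. c e * w) =
    Re w *\<^sub>R stem_of_components c + Im w *\<^sub>R iota_mult (stem_of_components c)"
  by (simp add: stem_of_components_def iota_mult_def scaleR_sum_right scaleR_diff_left scaleR_add_left
      sum.distrib sum_subtractf mult.commute)

lemma stem_of_components_has_derivative:
  assumes "\<And>e. (h e has_field_derivative d e) (at z)"
  shows "((\<lambda>z. stem_of_components (\<lambda>e. h e z)) has_derivative
    (\<lambda>w. Re w *\<^sub>R stem_of_components d + Im w *\<^sub>R iota_mult (stem_of_components d))) (at z)"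
proof -
  have h: "(h e has_derivative (\<lambda>w. d e * w)) (at z)" for e
    using assms by (simp add: has_field_derivative_def)
  have "((\<lambda>z. stem_of_components (\<lambda>e. h e z)) has_derivative (\<lambda>w. stem_of_components (\<lambda>e. d e * w))) (at z)"
    unfolding stem_of_components_def
    by (intro has_derivative_Pair has_derivative_sum has_derivative_scaleR_left
        bounded_linear.has_derivative[OF bounded_linear_Re]
        bounded_linear.has_derivative[OF bounded_linear_Im] h)
  then show ?thesis
    by (simp add: stem_of_components_mult)
qed

lemma stem_holomorphic_components:
  assumes "stem_holomorphic D F" "open D"
  obtains h where "\<And>e. h e holomorphic_on D" "\<And>z. F z = stem_of_components (\<lambda>e. h e z)"
proof
  define h where "h e z = Complex (fst (F z) \<bullet> e) (snd (F z) \<bullet> e)" for e z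
  show "F z = stem_of_components (\<lambda>e. h e z)" for z
    by (simp add: stem_of_components_def h_def euclidean_representation)
  show "h e holomorphic_on D" for e
    unfolding holomorphic_on_open[OF assms(2)]
  proof
    fix z assume "z \<in> D"
    then obtain F' where F': "(F has_derivative F') (at z)" "\<And>w. F' (\<i> * w) = iota_mult (F' w)"
      using assms(1) by (auto simp: stem_holomorphic_def)
    have expand: "F' w = Re w *\<^sub>R F' 1 + Im w *\<^sub>R iota_mult (F' 1)" for w
    proof -
      have "w = Re w *\<^sub>R 1 + Im w *\<^sub>R \<i>"
        by (simp add: complex_eq_iff)
      then have "F' w = F' (Re w *\<^sub>R 1 + Im w *\<^sub>R \<i>)"
        by (rule arg_cong)
      also have "\<dots> = Re w *\<^sub>R F' 1 + Im w *\<^sub>R F' \<i>"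
        by (simp only: linear_add[OF has_derivative_linear[OF F'(1)]]
            linear_scale[OF has_derivative_linear[OF F'(1)]])
      finally show ?thesis
        using F'(2)[of 1] by simp
    qed
    \<comment> \<open>A real-linear map that intertwines multiplication by \<i> with
      \<open>iota_mult\<close> becomes, in each component, multiplication by a fixed complex
      number.\<close>
    have eq: "complex_of_real (fst (F' w) \<bullet> e) + \<i> * complex_of_real (snd (F' w) \<bullet> e) =
        Complex (fst (F' 1) \<bullet> e) (snd (F' 1) \<bullet> e) * w" for w
      unfolding expand[of w]
      by (simp add: complex_eq_iff iota_mult_def inner_add_left inner_diff_left mult.commute)
    have "(h e has_derivative (\<lambda>w. complex_of_real (fst (F' w) \<bullet> e) + \<i> * complex_of_real (snd (F' w) \<bullet> e))) (at z)"
      unfolding h_def[abs_def] Complex_eq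
      by (intro has_derivative_add has_derivative_mult_right has_derivative_of_real
          has_derivative_inner_left has_derivative_fst has_derivative_snd F'(1))
    then show "\<exists>h'. (h e has_field_derivative h') (at z)"
      unfolding has_field_derivative_def eq by blast
  qed
qed

text \<open>Each component is holomorphic, so its complex derivative is again holomorphic;
  reassembling the components gives two derivatives of F, each already in Cauchy-Riemann
  form.\<close>

lemma stem_holomorphic_twice:
  assumes "stem_holomorphic D F" "open D"
  obtains F1 F2 where
    "\<And>z. z \<in> D \<Longrightarrow> (F has_derivative (\<lambda>w. Re w *\<^sub>R F1 z + Im w *\<^sub>R iota_mult (F1 z))) (at z)"
    "\<And>z. z \<in> D \<Longrightarrow> (F1 has_derivative (\<lambda>w. Re w *\<^sub>R F2 z + Im w *\<^sub>R iota_mult (F2 z))) (at z)"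
proof -
  obtain h where h: "\<And>e. h e holomorphic_on D" and F: "\<And>z. F z = stem_of_components (\<lambda>e. h e z)"
    using stem_holomorphic_components[OF assms] by blast
  have h1: "(h e has_field_derivative deriv (h e) z) (at z)" if "z \<in> D" for e z
    by (rule holomorphic_derivI[OF h assms(2) that])
  have h2: "(deriv (h e) has_field_derivative deriv (deriv (h e)) z) (at z)" if "z \<in> D" for e z
    by (rule holomorphic_derivI[OF holomorphic_deriv[OF h assms(2)] assms(2) that])
  show thesis
    by (rule that[of "\<lambda>z. stem_of_components (\<lambda>e. deriv (h e) z)"
          "\<lambda>z. stem_of_components (\<lambda>e. deriv (deriv (h e)) z)"])
      (use stem_of_components_has_derivative[OF h1] stem_of_components_has_derivative[OF h2]
        in \<open>simp_all add: F[abs_def]\<close>)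
qed

section \<open>The Laplacian of a slice-regular function\<close>

context slice_stem
begin

lemma slice_regular_twice:
  assumes "slice_regular D M f"
  obtains F2 where "\<And>z. z \<in> D \<Longrightarrow>
    ((\<lambda>z. F' z 1) has_derivative (\<lambda>w. Re w *\<^sub>R F2 z + Im w *\<^sub>R iota_mult (F2 z))) (at z)"
proof -
  obtain K where K: "stem_of_on D M f K" "stem_holomorphic D K"
    using assms by (auto simp: slice_regular_def)
  obtain F1 F2 where
    F1: "\<And>z. z \<in> D \<Longrightarrow> (K has_derivative (\<lambda>w. Re w *\<^sub>R F1 z + Im w *\<^sub>R iota_mult (F1 z))) (at z)"
    and F2: "\<And>z. z \<in> D \<Longrightarrow> (F1 has_derivative (\<lambda>w. Re w *\<^sub>R F2 z + Im w *\<^sub>R iota_mult (F2 z))) (at z)"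
    using stem_holomorphic_twice[OF K(2) open_D] by blast
  have eq: "F1 z = F' z 1" if "z \<in> D" for z
  proof -
    have "(F has_derivative (\<lambda>w. Re w *\<^sub>R F1 z + Im w *\<^sub>R iota_mult (F1 z))) (at z)"
      by (rule has_derivative_transform_within_open[OF F1[OF that] open_D that])
        (rule stem_unique[OF cnj_D K(1) stem])
    from has_derivative_unique[OF F'[OF that] this] show ?thesis
      by simp
  qed
  show thesis
    by (rule that[of F2], rule has_derivative_transform_within_open[OF F2 open_D]) (auto simp: eq)
qed

text \<open>After the Cauchy-Riemann equations are applied to the first derivatives, these are again
  built from axial functions and can be differentiated once more. The second derivatives of F cancel
  by harmonicity, so only first derivatives of G survive.\<close>

lemma laplace_slice:
  assumes reg: "slice_regular D M f" and x: "x \<in> M" "pt x \<in> D - \<real>"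
  shows "laplace_op v m f x = (real m - 1) *\<^sub>R (unit x * G' (pt x) \<i> - G' (pt x) 1)"
proof -
  obtain H where H: "\<And>z. z \<in> D \<Longrightarrow>
    ((\<lambda>z. F' z 1) has_derivative (\<lambda>w. Re w *\<^sub>R H z + Im w *\<^sub>R iota_mult (H z))) (at z)"
    using slice_regular_twice[OF reg] by blast
  have cr: "F' z \<i> = iota_mult (F' z 1)" if "z \<in> D" for z
    using reg that by (simp add: slice_regular_iff)
  define z where "z = pt x"
  define b where "b = N x"
  have b: "b \<noteq> 0" "Im z = b"
    using x by (auto simp: b_def pt_real_iff z_def) (simp add: pt_def)
  have z: "z \<in> D - \<real>" "z \<in> D"
    using x by (auto simp: z_def)
  text \<open>With \<open>F' = (p, q)\<close> and \<open>F'' = (p', q')\<close>, the Laplacian is computed from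
    \<open>\<partial>\<^sub>\<alpha> G = q / \<beta> = q1\<close> and \<open>\<partial>\<^sub>\<beta> G = \<beta> Q\<close>.\<close>
  define p q where "p = (\<lambda>z. fst (F' z 1))" and "q = (\<lambda>z. snd (F' z 1))"
  define p' q' where "p' = fst (H z)" and "q' = snd (H z)"
  have dp: "(p has_derivative (\<lambda>w. Re w *\<^sub>R p' - Im w *\<^sub>R q')) (at z)"
    using has_derivative_fst[OF H[OF z(2)]] by (simp add: p_def p'_def q'_def iota_mult_def)
  have dq: "(q has_derivative (\<lambda>w. Re w *\<^sub>R q' + Im w *\<^sub>R p')) (at z)"
    using has_derivative_snd[OF H[OF z(2)]] by (simp add: q_def p'_def q'_def iota_mult_def)
  define q1 where "q1 = (\<lambda>z. (1 / Im z) *\<^sub>R q z)"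
  define Q where "Q = (\<lambda>z. (1 / (Im z)\<^sup>2) *\<^sub>R (p z - G z))"
  have dIm: "(Im has_derivative Im) (at z)"
    by (rule bounded_linear_imp_has_derivative[OF bounded_linear_Im])
  have d1: "((\<lambda>z. 1 / Im z) has_derivative (\<lambda>w. - (Im w / b\<^sup>2))) (at z)"
    using b by (auto intro!: derivative_eq_intros dIm simp: power2_eq_square field_simps)
  have d2: "((\<lambda>z. 1 / (Im z)\<^sup>2) has_derivative (\<lambda>w. - (2 * Im w / b^3))) (at z)"
    using b by (auto intro!: derivative_eq_intros dIm simp: power2_eq_square power3_eq_cube field_simps)
  define q1' where "q1' w = (1 / b) *\<^sub>R (Re w *\<^sub>R q' + Im w *\<^sub>R p') + (- (Im w / b\<^sup>2)) *\<^sub>R q z" for w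
  have dq1: "(q1 has_derivative q1') (at z)"
    using has_derivative_scaleR[OF d1 dq] b by (simp add: q1_def q1'_def[abs_def])
  define Q' where "Q' w = (1 / b\<^sup>2) *\<^sub>R (Re w *\<^sub>R p' - Im w *\<^sub>R q' - G' z w) +
      (- (2 * Im w / b^3)) *\<^sub>R (p z - G z)" for w
  have dQ: "(Q has_derivative Q') (at z)"
    using has_derivative_scaleR[OF d2 has_derivative_diff[OF dp G'[OF z(1)]]] b
    by (simp add: Q_def Q'_def[abs_def])
  have G'_i: "G' y \<i> = Im y *\<^sub>R Q y" and G'_1: "G' y 1 = q1 y" if "y \<in> D - \<real>" for y
    using that cr[of y]
    by (auto simp: G'_def Q_def q1_def p_def q_def G_def iota_mult_def scaleR_diff_right power2_eq_square
        complex_is_Real_iff)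
  have q1'_i: "b *\<^sub>R q1' \<i> = p' - q1 z"
    using b by (simp add: q1'_def q1_def scaleR_diff_right power2_eq_square)
  \<comment> \<open>The 3 is 2 from differentiating the factor \<open>1 / \<beta>^2\<close> of Q,
    plus 1 from differentiating the \<open>- G\<close> inside it.\<close>
  have Q'_i: "b *\<^sub>R Q' \<i> = - ((1 / b) *\<^sub>R q') - 3 *\<^sub>R Q z"
  proof -
    have "p z - G z = b\<^sup>2 *\<^sub>R Q z"
      using b by (simp add: Q_def)
    then have "b *\<^sub>R Q' \<i> = b *\<^sub>R ((1 / b\<^sup>2) *\<^sub>R (- q' - b *\<^sub>R Q z) + (- (2 / b^3)) *\<^sub>R (b\<^sup>2 *\<^sub>R Q z))"
      using b G'_i[OF z(1)] by (simp add: Q'_def)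
    also have "\<dots> = - ((b * (1 / b\<^sup>2)) *\<^sub>R q') + (- (b * (1 / b\<^sup>2) * b) - b * (2 / b^3) * b\<^sup>2) *\<^sub>R Q z"
      by (simp add: scaleR_add_right scaleR_diff_right scaleR_diff_left mult.assoc)
    also have "- (b * (1 / b\<^sup>2) * b) - b * (2 / b^3) * b\<^sup>2 = - 3"
      using b by (simp add: power2_eq_square power3_eq_cube field_simps)
    also have "b * (1 / b\<^sup>2) = 1 / b"
      using b by (simp add: power2_eq_square)
    finally show ?thesis
      by simp
  qed
  have N: "N x \<noteq> 0"
    using b by (simp add: b_def)
  have first_0: "pderiv_dir v 0 f y = p (pt y) + V y * q1 (pt y)" if "y \<in> M" "pt y \<in> D - \<real>" for y
    using that pderiv_0[OF that] 
    by (simp add: p_def q1_def q_def unit_def pt_real_iff alg_scaleR_left alg_scaleR_right) (simp add: pt_def)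
  have second_0: "pderiv_dir v 0 (pderiv_dir v 0 f) x = p' + (1 / b) *\<^sub>R (V x * q')"
    using pderiv_axial[OF open_D' x N first_0 dp[unfolded z_def] dq1[unfolded z_def], of 0]
    by (simp add: q1'_def alg_scaleR_right)
  \<comment> \<open>The \<beta>-derivatives of \<open>F_1\<close> and G are
    \<open>- \<beta> q1\<close> and \<open>\<beta> Q\<close>, so the denominator of
    \<open>X i y / N y\<close> cancels. The formula holds at all nonreal y, as the second
    differentiation demands.\<close>
  have first_i: "pderiv_dir v i f y = v i * G (pt y) + X i y *\<^sub>R (- q1 (pt y) + V y * Q (pt y))"
    if "y \<in> M" "pt y \<in> D - \<real>" "i \<in> {1..m}" for i y
  proof -
    have "N y \<noteq> 0" "Im (pt y) = N y" "pt y \<in> D"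
      using that by (auto simp: pt_real_iff) (simp add: pt_def)
    then show ?thesis
      using pderiv_axial[OF axial(1-5)[OF that(1,2)] has_derivative_fst[OF F'] G'[OF that(2)], of i] that(3)
        cr[of "pt y"] G'_i[OF that(2)]
      by (simp add: iota_mult_def q1_def q_def alg_scaleR_right scaleR_add_right scaleR_diff_right add.commute)
  qed
  have second_i: "pderiv_dir v i (pderiv_dir v i f) x =
      (2 * X i x) *\<^sub>R (v i * Q z) + ((X i x)\<^sup>2 / b) *\<^sub>R (- q1' \<i> + V x * Q' \<i>) + (- q1 z + V x * Q z)"
    if i: "i \<in> {1..m}" for i
  proof -
    have im: "i \<le> m" "i \<noteq> 0"
      using i by auto
    note pt = pt_has_vector_derivative[OF im(1) N]
    have "((\<lambda>s. G (pt (x + s *\<^sub>R v i))) has_vector_derivative G' z ((X i x / b) *\<^sub>R \<i>)) (at 0)"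
      using has_vector_derivative_compose[OF pt, of G "G' z"] G'[OF z(1)] im by (simp add: z_def b_def)
    moreover have "G' z ((X i x / b) *\<^sub>R \<i>) = X i x *\<^sub>R Q z"
      using linear_scale[OF has_derivative_linear[OF G'[OF z(1)]], of "X i x / b" \<i>] G'_i[OF z(1)] b by simp
    ultimately have 1: "((\<lambda>s. v i * G (pt (x + s *\<^sub>R v i))) has_vector_derivative X i x *\<^sub>R (v i * Q z)) (at 0)"
      using bounded_linear.has_vector_derivative[OF alg.bounded_linear_right] by (metis alg_scaleR_right)
    have "((\<lambda>z. - q1 z) has_derivative (\<lambda>w. - q1' w)) (at (pt x))"
      using has_derivative_minus[OF dq1] by (simp add: z_def)
    note 2 = axial_line_has_vector_derivative[OF N im(1) this dQ[unfolded z_def]]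
    have "((\<lambda>s. X i (x + s *\<^sub>R v i)) has_real_derivative 1) (at 0)"
      using im by (auto simp: X_simps X_v intro!: derivative_eq_intros)
    note 3 = has_vector_derivative_scaleR[OF this 2]
    \<comment> \<open>The term \<open>v i * Q z\<close> arises twice, from G in
      \<open>v i * G\<close> and from V in \<open>V x * Q\<close>, which explains the coefficient
      2.\<close>
    have regroup: "r *\<^sub>R y + (r *\<^sub>R ((r / b) *\<^sub>R T + y) + 1 *\<^sub>R W) = (2 * r) *\<^sub>R y + (r\<^sup>2 / b) *\<^sub>R T + W"
      for r and y T W :: 'a
    proof -
      have "(2 * r) *\<^sub>R y = r *\<^sub>R y + r *\<^sub>R y"
        by (simp only: mult_2 scaleR_add_left)
      then show ?thesis
        by (simp add: scaleR_add_right power2_eq_square)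
    qed
    have 4: "((\<lambda>s. v i * G (pt (x + s *\<^sub>R v i)) + X i (x + s *\<^sub>R v i) *\<^sub>R
        (- q1 (pt (x + s *\<^sub>R v i)) + V (x + s *\<^sub>R v i) * Q (pt (x + s *\<^sub>R v i)))) has_vector_derivative
        (2 * X i x) *\<^sub>R (v i * Q z) + ((X i x)\<^sup>2 / b) *\<^sub>R (- q1' \<i> + V x * Q' \<i>) + (- q1 z + V x * Q z)) (at 0)"
      by (rule has_vector_derivative_eq_rhs[OF has_vector_derivative_add[OF 1 3]])
        (use im in \<open>simp only: scaleR_zero_left add_0_right if_False z_def b_def regroup[unfolded b_def]\<close>)
    show ?thesis
      by (rule pderiv_line_cong[OF open_D' x im(1) first_i[OF _ _ i] 4])
  qed
  have "(\<Sum>i=1..m. pderiv_dir v i (pderiv_dir v i f) x) =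
      (\<Sum>i=1..m. 2 *\<^sub>R ((X i x *\<^sub>R v i) * Q z) + (X i x)\<^sup>2 *\<^sub>R ((1 / b) *\<^sub>R (- q1' \<i> + V x * Q' \<i>))
         + (- q1 z + V x * Q z))"
    by (intro sum.cong refl) (simp add: second_i alg_scaleR_left)
  also have "\<dots> = 2 *\<^sub>R (V x * Q z) + b\<^sup>2 *\<^sub>R ((1 / b) *\<^sub>R (- q1' \<i> + V x * Q' \<i>)) + real m *\<^sub>R (- q1 z + V x * Q z)"
  proof -
    have V: "(\<Sum>i=1..m. (X i x *\<^sub>R v i) * Q z) = V x * Q z"
      by (simp add: V_def alg.sum_left)
    have b: "(\<Sum>i=1..m. (X i x)\<^sup>2 *\<^sub>R T) = b\<^sup>2 *\<^sub>R T" for T :: 'a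
      by (simp add: b_def N_sq scaleR_sum_left)
    show ?thesis
      by (simp only: sum.distrib sum_constant_scaleR b V scaleR_sum_right[symmetric]) (simp add: scaleR_diff_right)
  qed
  also have "b\<^sup>2 *\<^sub>R ((1 / b) *\<^sub>R (- q1' \<i> + V x * Q' \<i>)) = - (b *\<^sub>R q1' \<i>) + V x * (b *\<^sub>R Q' \<i>)"
    using b by (simp add: power2_eq_square scaleR_add_right scaleR_diff_right alg_scaleR_right)
  also have "\<dots> = q1 z - p' - (1 / b) *\<^sub>R (V x * q') - 3 *\<^sub>R (V x * Q z)"
    by (simp add: q1'_i Q'_i alg.diff_right alg.minus_right alg_scaleR_right)
  finally have sum: "(\<Sum>i=1..m. pderiv_dir v i (pderiv_dir v i f) x) = 2 *\<^sub>R (V x * Q z) +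
      (q1 z - p' - (1 / b) *\<^sub>R (V x * q') - 3 *\<^sub>R (V x * Q z)) + real m *\<^sub>R (- q1 z + V x * Q z)" .
  \<comment> \<open>Here \<open>p'\<close> and \<open>q'\<close> cancel, and the coefficients of
    \<open>V x * Q z\<close> and \<open>q1 z\<close> are 2 - 3 + m and 1 - m.\<close>
  have "laplace_op v m f x = p' + (1 / b) *\<^sub>R (V x * q') + (\<Sum>i=1..m. pderiv_dir v i (pderiv_dir v i f) x)"
    by (simp add: laplace_op_def sum.atLeast_Suc_atMost[of 0] second_0)
  also have "\<dots> = (real m - 1) *\<^sub>R (V x * Q z - q1 z)"
  proof -
    have "2 *\<^sub>R y - 3 *\<^sub>R y = - y" for y :: 'a
      by (simp flip: scaleR_diff_left)
    then show ?thesis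
      unfolding sum by (simp add: scaleR_diff_right scaleR_diff_left scaleR_add_right algebra_simps)
  qed
  also have "V x * Q z = unit x * G' (pt x) \<i>"
    using b G'_i[OF z(1)] N_unit[of x] by (simp add: z_def b_def alg_scaleR_right flip: alg_scaleR_left)
  also have "q1 z = G' (pt x) 1"
    using G'_1[OF z(1)] by (simp add: z_def)
  finally show ?thesis .
qed

end

subsection \<open>Rigidity of slice-regular functions\<close>

context slice_stem
begin

lemma Omega_iff: "x \<in> axial_set D \<inter> M \<longleftrightarrow> x \<in> M \<and> pt x \<in> D"
  using axial_set_iff[OF cnj_D] by auto

lemma Omega_nonreal_iff: "x \<in> (axial_set D \<inter> M) - real_line \<longleftrightarrow> x \<in> M \<and> pt x \<in> D - \<real>"
  using Omega_iff[of x] real_line_iff[of x] pt_real_iff[of x] by auto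

lemma F_continuous: "continuous_on D F"
  using F' by (meson continuous_at_imp_continuous_on has_derivative_continuous)

text \<open>G says nothing at real points, so the vanishing is transferred to the stem function (0,
  \<open>F_2\<close>), which is continuous on D.\<close>

lemma snd_F_eq_0:
  assumes "\<And>x. x \<in> M \<Longrightarrow> pt x \<in> D - \<real> \<Longrightarrow> G (pt x) = 0" and "z \<in> D"
  shows "snd (F z) = 0"
proof -
  define \<Phi> where "\<Phi> z = (0::'a, snd (F z))" for z
  have "\<Phi> z = 0"
  proof (rule stem_zero_of_slice_zero'[OF open_D cnj_D _ _ _ assms(2), of \<Phi>])
    show "continuous_on D \<Phi>"
      unfolding \<Phi>_def by (intro continuous_intros F_continuous)
    show "stem_function D \<Phi>"
      using stem_F by (simp add: stem_function_def \<Phi>_def cplx_bar_def)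
    fix x assume "x \<in> M" "pt x \<in> D" "N x \<noteq> 0"
    then show "fst (\<Phi> (pt x)) + unit x * snd (\<Phi> (pt x)) = 0"
      using assms(1)[of x] pt_real_iff[of x]
      by (auto simp: \<Phi>_def G_def alg.zero_right complex_is_Real_iff)
  qed
  then show ?thesis
    by (simp add: \<Phi>_def prod_eq_iff)
qed

lemma snd_F'_eq_0:
  assumes "\<And>z. z \<in> D \<Longrightarrow> snd (F z) = 0" and "z \<in> D"
  shows "snd (F' z w) = 0"
proof -
  have "((\<lambda>z. 0::'a) has_derivative (\<lambda>w. snd (F' z w))) (at z)"
    by (rule has_derivative_transform_within_open[OF has_derivative_snd[OF F'[OF assms(2)]] open_D assms(2)])
      (simp add: assms(1))
  from has_derivative_unique[OF this has_derivative_const] show ?thesis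
    by (simp add: fun_eq_iff)
qed

text \<open>With \<open>F_2 = 0\<close> the value depends on \<open>pt x\<close> only. Thus F being
  constant on a disc makes f constant on the preimage of the disc under the continuous map
  \<open>pt\<close>.\<close>

lemma locally_constant_slice:
  assumes snd: "\<And>z. z \<in> D \<Longrightarrow> snd (F z) = 0"
    and der: "\<And>z. z \<in> D \<Longrightarrow> fst (F' z 1) = 0" "\<And>z. z \<in> D \<Longrightarrow> fst (F' z \<i>) = 0"
  shows "locally_constant_on (axial_set D \<inter> M) f"
  unfolding locally_constant_on_def
proof
  fix x assume "x \<in> axial_set D \<inter> M"
  then have x: "x \<in> M" "pt x \<in> D"
    using Omega_iff by auto
  obtain r where r: "0 < r" "ball (pt x) r \<subseteq> D"
    using open_D x(2) open_contains_ball by blast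
  have "(F has_derivative (\<lambda>w. 0)) (at z within ball (pt x) r)" if "z \<in> ball (pt x) r" for z
  proof -
    have z: "z \<in> D"
      using that r by auto
    have "F' z w = 0" for w
      using snd_F'_eq_0[OF snd z] der[OF z] F'_expand[OF z, of w] by (simp add: prod_eq_iff)
    then have "F' z = (\<lambda>w. 0)"
      by auto
    then show ?thesis
      using F'[OF z] has_derivative_at_withinI by metis
  qed
  then obtain c where c: "\<And>z. z \<in> ball (pt x) r \<Longrightarrow> F z = c"
    using has_derivative_zero_constant[of "ball (pt x) r" F] by auto
  define U where "U = (axial_set D \<inter> M) \<inter> pt -` ball (pt x) r"
  have "openin (top_of_set (axial_set D \<inter> M)) U"
    unfolding U_def using open_vimage[OF open_ball continuous_on_pt] by (rule openin_open_Int)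
  moreover have "x \<in> U"
    using \<open>x \<in> axial_set D \<inter> M\<close> r by (simp add: U_def)
  moreover have "f y = fst c" if "y \<in> U" for y
  proof -
    have y: "y \<in> M" "pt y \<in> D" "pt y \<in> ball (pt x) r"
      using that Omega_iff[of y] by (auto simp: U_def)
    then show ?thesis
      using value_M[OF y(1,2)] c[OF y(3)] snd[OF y(2)] by (simp add: alg.zero_right)
  qed
  ultimately show "\<exists>U. openin (top_of_set (axial_set D \<inter> M)) U \<and> x \<in> U \<and> f constant_on U"
    by (auto simp: constant_on_def)
qed

text \<open>The condition on the right omits the real line, whereas holomorphy is required on all of
  D; continuity of \<open>F'\<close> bridges the gap.\<close>

lemma slice_regular_iff_slice_dxc:
  assumes cont: "\<And>w. continuous_on D (\<lambda>z. F' z w)"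
  shows "slice_regular D M f \<longleftrightarrow> (\<forall>x\<in>(axial_set D \<inter> M) - real_line. slice_dxc D M f x = 0)"
proof
  assume "slice_regular D M f"
  then have *: "\<forall>z\<in>D. F' z \<i> = iota_mult (F' z 1)"
    by (simp add: slice_regular_iff)
  show "\<forall>x\<in>(axial_set D \<inter> M) - real_line. slice_dxc D M f x = 0"
  proof
    fix x assume "x \<in> (axial_set D \<inter> M) - real_line"
    then have x: "x \<in> M" "pt x \<in> D - \<real>"
      using Omega_nonreal_iff by auto
    then show "slice_dxc D M f x = 0"
      using * slice_dxs(2)[OF x] by (simp add: iota_mult_def alg.zero_right)
  qed
next
  assume *: "\<forall>x\<in>(axial_set D \<inter> M) - real_line. slice_dxc D M f x = 0"
  define \<Phi> where "\<Phi> z = F' z 1 + iota_mult (F' z \<i>)" for z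
  have "\<Phi> z = 0" if "z \<in> D" for z
  proof (rule stem_zero_of_slice_zero'[OF open_D cnj_D _ _ _ that, of \<Phi>])
    show "continuous_on D \<Phi>"
      unfolding \<Phi>_def iota_mult_def by (intro continuous_intros cont)
    show "stem_function D \<Phi>"
      by (auto simp: stem_function_def \<Phi>_def stem_F' F'_minus cplx_bar_def iota_mult_def prod_eq_iff)
    fix x assume "x \<in> M" "pt x \<in> D" "N x \<noteq> 0"
    then have x: "x \<in> M" "pt x \<in> D - \<real>"
      by (auto simp: pt_real_iff)
    then have "slice_dxc D M f x = 0"
      using * Omega_nonreal_iff by blast
    then show "fst (\<Phi> (pt x)) + unit x * snd (\<Phi> (pt x)) = 0"
      using slice_dxs(2)[OF x] by (simp add: \<Phi>_def iota_mult_def)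
  qed
  then have "F' z \<i> = iota_mult (F' z 1)" if "z \<in> D" for z
    using that by (fastforce simp: \<Phi>_def iota_mult_def prod_eq_iff add_eq_0_iff)
  then show "slice_regular D M f"
    by (simp add: slice_regular_iff)
qed

text \<open>Lines in the directions \<open>v i\<close> stay in M, and near x in \<Omega>, so each
  partial derivative equals \<open>f' x\<close> applied to \<open>v i\<close>. Hence the operator is
  continuous on \<Omega> and its vanishing passes to real points.\<close>

lemma dbar_zero_extend:
  assumes f: "C1_on (axial_set D \<inter> M) f"
    and zero: "\<And>x. x \<in> (axial_set D \<inter> M) - real_line \<Longrightarrow> dbar_op v m f x = 0"
    and x: "x \<in> axial_set D \<inter> M"
  shows "dbar_op v m f x = 0"
proof -
  let ?\<Omega> = "{x \<in> M. pt x \<in> D}"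
  have \<Omega>: "axial_set D \<inter> M = ?\<Omega>"
    using Omega_iff by auto
  obtain f' where f': "\<And>x. x \<in> ?\<Omega> \<Longrightarrow> (f has_derivative blinfun_apply (f' x)) (at x within ?\<Omega>)"
    and cont: "continuous_on ?\<Omega> f'"
    using f by (auto simp: C1_on_def \<Omega>)
  have pd: "pderiv_dir v i f x = blinfun_apply (f' x) (v i)" if x: "x \<in> ?\<Omega>" and i: "i \<le> m" for i x
  proof -
    define S where "S = {s. pt (x + s *\<^sub>R v i) \<in> D}"
    have S: "open S" "0 \<in> S"
      using x unfolding S_def by (auto intro: pt_line_open[OF open_D])
    have line: "((\<lambda>s. x + s *\<^sub>R v i) has_derivative (\<lambda>s. s *\<^sub>R v i)) (at 0 within S)"
      by (auto intro!: derivative_eq_intros)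
    have "(\<lambda>s. x + s *\<^sub>R v i) ` S \<subseteq> ?\<Omega>"
      using x i by (auto simp: S_def line_in_M)
    then have "(f has_derivative blinfun_apply (f' x)) (at (x + 0 *\<^sub>R v i) within (\<lambda>s. x + s *\<^sub>R v i) ` S)"
      using has_derivative_subset[OF f'[OF x]] by simp
    from has_derivative_in_compose[OF line this]
    have "((\<lambda>s. f (x + s *\<^sub>R v i)) has_vector_derivative blinfun_apply (f' x) (v i)) (at 0 within S)"
      by (simp add: has_vector_derivative_def blinfun.scaleR_right)
    then have "((\<lambda>s. f (x + s *\<^sub>R v i)) has_vector_derivative blinfun_apply (f' x) (v i)) (at 0)"
      by (simp only: has_vector_derivative_within_open[OF S(2,1)])
    then show ?thesis
      by (simp add: pderiv_dir_def vector_derivative_at)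
  qed
  have "continuous_on ?\<Omega> (dbar_op v m f)"
  proof (rule continuous_on_eq)
    show "continuous_on ?\<Omega> (\<lambda>x. (1/2) *\<^sub>R (blinfun_apply (f' x) (v 0) + (\<Sum>i=1..m. v i * blinfun_apply (f' x) (v i))))"
      by (intro continuous_intros cont bounded_linear.continuous_on[OF alg.bounded_linear_right])
  qed (simp add: dbar_op_def pd)
  then show ?thesis
  proof (rule continuous_zero_off_real_line[OF open_D])
    show "x \<in> M" "pt x \<in> D"
      using x Omega_iff[of x] by auto
    fix y assume "y \<in> M" "pt y \<in> D" "N y \<noteq> 0"
    then show "dbar_op v m f y = 0"
      using zero Omega_nonreal_iff[of y] by (simp add: pt_real_iff)
  qed
qed

lemma affine_slice:
  assumes reg: "slice_regular D M f" and m: "1 < m"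
    and zero: "\<And>x. x \<in> axial_set D \<inter> M \<Longrightarrow> laplace_op v m f x = 0"
    and C: "C \<in> components (axial_set D \<inter> M)"
  shows "\<exists>a b. \<forall>x\<in>C. f x = x * a + b"
proof -
  obtain H where H: "\<And>z. z \<in> D \<Longrightarrow>
    ((\<lambda>z. F' z 1) has_derivative (\<lambda>w. Re w *\<^sub>R H z + Im w *\<^sub>R iota_mult (H z))) (at z)"
    using slice_regular_twice[OF reg] by blast
  have cr: "F' z \<i> = iota_mult (F' z 1)" if "z \<in> D" for z
    using reg that by (simp add: slice_regular_iff)
  have G'_0: "G' z 1 = 0 \<and> G' z \<i> = 0" if z: "z \<in> D" "0 < Im z" for z
  proof -
    \<comment> \<open>This pair is twice the stem function of the slice derivative of the spherical
      derivative; the Laplacian is its slice value times 1 - m, and m > 1 allows the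
      division.\<close>
    have "(\<lambda>z. (G' z 1, - G' z \<i>)) z = 0"
    proof (rule stem_zero_of_slice_zero[OF _ z])
      fix x assume "x \<in> M" "pt x \<in> D" "N x \<noteq> 0"
      then have x: "x \<in> M" "pt x \<in> D - \<real>"
        by (auto simp: pt_real_iff)
      then have "laplace_op v m f x = 0"
        using zero Omega_iff by auto
      then show "fst (G' (pt x) 1, - G' (pt x) \<i>) + unit x * snd (G' (pt x) 1, - G' (pt x) \<i>) = 0"
        using laplace_slice[OF reg x] m by (simp add: alg.minus_right)
    qed
    then show ?thesis
      by (simp add: prod_eq_iff)
  qed
  have cont_F'1: "continuous_on D (\<lambda>z. F' z 1)"
    using H by (meson continuous_at_imp_continuous_on has_derivative_continuous)
  text \<open>\<open>\<partial>f\<^sub>s'/\<partial>x = 0\<close> says that \<open>F' = (p, 0)\<close> and \<open>F\<^sub>2 = \<beta> p\<close>.\<close>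
  define \<Phi> where "\<Phi> z = (0::'a, snd (F' z 1))" for z
  define \<Psi> where "\<Psi> z = (0::'a, snd (F z) - Im z *\<^sub>R fst (F' z 1))" for z
  have "\<Phi> z = 0 \<and> \<Psi> z = 0" if "z \<in> D" for z
  proof -
    have *: "snd (F' (pt x) 1) = 0" "snd (F (pt x)) = Im (pt x) *\<^sub>R fst (F' (pt x) 1)"
      if "x \<in> M" "pt x \<in> D" "N x \<noteq> 0" for x
    proof -
      have Im: "0 < Im (pt x)"
        using that N_ge_0[of x] by (simp add: pt_def)
      then show "snd (F' (pt x) 1) = 0"
        using G'_0[OF that(2)] by (simp add: G'_def)
      have "(Im (pt x))\<^sup>2 *\<^sub>R G' (pt x) \<i> = Im (pt x) *\<^sub>R fst (F' (pt x) 1) - snd (F (pt x))"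
        using Im cr[OF that(2)] by (simp add: G'_def iota_mult_def scaleR_diff_right power2_eq_square)
      then show "snd (F (pt x)) = Im (pt x) *\<^sub>R fst (F' (pt x) 1)"
        using G'_0[OF that(2) Im] by simp
    qed
    have "\<Phi> z = 0"
      by (rule stem_zero_of_slice_zero'[OF open_D cnj_D _ _ _ that, of \<Phi>])
        (auto simp: \<Phi>_def stem_function_def stem_F' cplx_bar_def * alg.zero_right
          intro!: continuous_intros cont_F'1)
    moreover have "\<Psi> z = 0"
    proof (rule stem_zero_of_slice_zero'[OF open_D cnj_D _ _ _ that, of \<Psi>])
      show "continuous_on D \<Psi>"
        unfolding \<Psi>_def by (intro continuous_intros cont_F'1 F_continuous)
      show "stem_function D \<Psi>"
        using stem_F by (simp add: \<Psi>_def stem_function_def stem_F' cplx_bar_def)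
    qed (simp_all add: \<Psi>_def * alg.zero_right)
    ultimately show ?thesis
      by simp
  qed
  then have q: "snd (F' z 1) = 0" and F2: "snd (F z) = Im z *\<^sub>R fst (F' z 1)" if "z \<in> D" for z
    using that by (auto simp: \<Phi>_def \<Psi>_def prod_eq_iff)
  define p where "p = (\<lambda>z. fst (F' z 1))"
  have dp: "(p has_derivative (\<lambda>w. 0)) (at z)" if z: "z \<in> D" for z
  proof -
    \<comment> \<open>The second component of \<open>F' z 1\<close> vanishes on an open set, so its
      derivative does too; by the Cauchy-Riemann form this derivative contains both components of
      H.\<close>
    have "((\<lambda>z. 0::'a) has_derivative (\<lambda>w. Re w *\<^sub>R snd (H z) + Im w *\<^sub>R fst (H z))) (at z)"
      by (rule has_derivative_transform_within_open[OF _ open_D z, of "\<lambda>z. snd (F' z 1)"])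
        (use has_derivative_snd[OF H[OF z]] q in \<open>simp_all add: iota_mult_def\<close>)
    from has_derivative_unique[OF this has_derivative_const]
    have "Re w *\<^sub>R snd (H z) + Im w *\<^sub>R fst (H z) = 0" for w
      by (simp add: fun_eq_iff)
    from this[of 1] this[of \<i>] have "H z = 0"
      by (simp add: prod_eq_iff)
    then show ?thesis
      using has_derivative_fst[OF H[OF z]] by (simp add: p_def iota_mult_def)
  qed
  obtain x0 where x0: "x0 \<in> C"
    using in_components_nonempty[OF C] by blast
  have C_sub: "x \<in> M \<and> pt x \<in> D" if "x \<in> C" for x
    using in_components_subset[OF C] that Omega_iff by blast
  \<comment> \<open>The image of C under \<open>pt\<close> lies in the closed upper half-plane and
    need not be open, so derivatives are integrated on the component of D that contains it.\<close>
  define E where "E = connected_component_set D (pt x0)"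
  have E: "open E" "connected E" "E \<subseteq> D"
    unfolding E_def using open_connected_component[OF open_D]
    by (auto simp: connected_component_subset)
  have C_E: "pt x \<in> E" if "x \<in> C" for x
  proof -
    have "connected (pt ` C)"
      by (intro connected_continuous_image continuous_on_pt in_components_connected[OF C])
    then have "pt ` C \<subseteq> E"
      unfolding E_def using C_sub x0 by (intro connected_component_maximal) auto
    then show ?thesis
      using that by auto
  qed
  have const: "h constant_on E" if "\<And>z. z \<in> E \<Longrightarrow> (h has_derivative (\<lambda>w. 0)) (at z)" for h :: "complex \<Rightarrow> 'a"
  proof (rule has_derivative_zero_connected_constant_on[OF E(2,1) finite.emptyI])
    show "continuous_on E h"
      by (meson that has_derivative_continuous continuous_at_imp_continuous_on)
    show "\<forall>z\<in>E - {}. (h has_derivative (\<lambda>w. 0)) (at z within E)"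
      using that has_derivative_at_withinI by blast
  qed
  obtain a where a: "\<And>z. z \<in> E \<Longrightarrow> p z = a"
  proof -
    have "p constant_on E"
      by (rule const) (use dp E(3) in blast)
    then show ?thesis
      using that by (auto simp: constant_on_def)
  qed
  have "((\<lambda>z. fst (F z) - Re z *\<^sub>R a) has_derivative (\<lambda>w. 0)) (at z)" if z: "z \<in> E" for z
  proof -
    have zD: "z \<in> D"
      using z E by auto
    have "((\<lambda>z. fst (F z) - Re z *\<^sub>R a) has_derivative (\<lambda>w. fst (F' z w) - Re w *\<^sub>R a)) (at z)"
      by (intro has_derivative_diff has_derivative_fst F' zD has_derivative_scaleR_left
          bounded_linear_imp_has_derivative bounded_linear_Re)
    moreover have "fst (F' z w) - Re w *\<^sub>R a = 0" for w
      using F'_expand[OF zD, of w] cr[OF zD] q[OF zD] a[OF z] by (simp add: iota_mult_def p_def)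
    ultimately show ?thesis
      by simp
  qed
  from const[OF this] obtain b where b: "\<And>z. z \<in> E \<Longrightarrow> fst (F z) - Re z *\<^sub>R a = b"
    by (auto simp: constant_on_def)
  have "f x = x * a + b" if x: "x \<in> C" for x
  proof -
    define z where "z = pt x"
    have z: "z \<in> E" "z \<in> D"
      using C_E[OF x] E by (auto simp: z_def)
    have "f x = fst (F z) + unit x * snd (F z)"
      using value_M C_sub[OF x] by (simp add: z_def)
    also have "\<dots> = (b + Re z *\<^sub>R a) + unit x * (Im z *\<^sub>R a)"
      using b[OF z(1)] F2[OF z(2)] a[OF z(1)] by (simp add: p_def algebra_simps)
    also have "\<dots> = (Re z *\<^sub>R 1 + Im z *\<^sub>R unit x) * a + b"
      by (simp add: alg.add_left alg_scaleR_left alg_scaleR_right alg_one_left add_ac)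
    also have "Re z *\<^sub>R 1 + Im z *\<^sub>R unit x = x"
      using M_polar[of x] C_sub[OF x] by (simp add: z_def)
    finally show ?thesis .
  qed
  then show ?thesis
    by blast
qed

end

text \<open>The spherical derivative is treated as a slice function over \<open>D - \<real>\<close>,
  its natural domain. Affinity is asserted on each component, since a disconnected \<Omega> admits
  different coefficients on different components.\<close>

theorem proposition9:
  fixes M :: "'a::alternative_star_algebra set"
    and m :: nat and v :: "nat \<Rightarrow> 'a"
    and D :: "complex set" and \<Omega> :: "'a set"
    and f :: "'a \<Rightarrow> 'a" and c :: real
  assumes "(imag_units :: 'a set) \<noteq> {}"
    and "subspace M" and "real_line \<subseteq> M" and "M \<subseteq> quadratic_cone"
    and "m = dim M - 1" and "m > 1"
    and "orthonormal_basis M m v"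
    and "open D" and "\<And>z. z \<in> D \<Longrightarrow> cnj z \<in> D"
    and "\<Omega> = axial_set D \<inter> M"
    and "slice_function D M f" and "C1_on \<Omega> f"
    and "\<not> (\<forall>x y z :: 'a. (x * y) * z = x * (y * z)) \<Longrightarrow> admissible M v m \<Omega> f"
    and "c = (1 - real m) / 2"
  shows
    "(\<forall>x\<in>\<Omega> - real_line. Gamma_op v m f x = (real m - 1) *\<^sub>R (alg_Im x * spherical_deriv f x)) \<and>
     (\<forall>x\<in>\<Omega> - real_line. dbar_op v m f x = slice_dxc D M f x + c *\<^sub>R spherical_deriv f x) \<and>
     (\<forall>x\<in>\<Omega> - real_line. d_op v m f x = slice_dx D M f x - c *\<^sub>R spherical_deriv f x) \<and>
     (\<forall>x\<in>\<Omega> - real_line.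
        slice_dx (D - \<real>) M (spherical_deriv f) x = d_op v m (spherical_deriv f) x) \<and>
     (slice_regular D M f \<longleftrightarrow>
        (\<forall>x\<in>\<Omega> - real_line. dbar_op v m f x = c *\<^sub>R spherical_deriv f x)) \<and>
     ((\<forall>x\<in>\<Omega>. dbar_op v m f x = 0) \<longleftrightarrow>
        (\<forall>x\<in>\<Omega> - real_line. slice_dxc D M f x = - (c *\<^sub>R spherical_deriv f x))) \<and>
     (slice_regular D M f \<longrightarrow>
        (\<forall>x\<in>\<Omega> - real_line.
           laplace_op v m f x = (4 * c) *\<^sub>R slice_dx (D - \<real>) M (spherical_deriv f) x \<and>
           alg_Im x * laplace_op v m f x =
             (2 * c) *\<^sub>R (slice_dx D M f x - spherical_deriv f x))) \<and>
     ((\<forall>x\<in>\<Omega>. dbar_op v m f x = 0) \<and> slice_regular D M f \<longrightarrow> locally_constant_on \<Omega> f) \<and>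
     ((\<forall>x\<in>\<Omega>. d_op v m f x = 0) \<and> (\<forall>x\<in>\<Omega>. slice_dx D M f x = 0) \<longrightarrow>
        locally_constant_on \<Omega> f) \<and>
     (slice_regular D M f \<and> (\<forall>x\<in>\<Omega>. laplace_op v m f x = 0) \<longrightarrow>
        (\<forall>C\<in>components \<Omega>. \<exists>a b. \<forall>x\<in>C. f x = x * a + b))"
proof -
  interpret orthonormal_frame v m
    using assms(6,7) by unfold_locales (auto simp: orthonormal_basis_def)
  have M: "M = span (v ` {..m})"
    using assms(7) by (simp add: orthonormal_basis_def)
  obtain F where F: "stem_of_on D (span (v ` {..m})) f F"
    using assms(11) by (auto simp: slice_function_def M)
  have C1: "C1_on (axial_set D \<inter> span (v ` {..m})) f"
    using assms(10,12) by (simp add: M)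
  obtain F' where F': "\<And>z. z \<in> D \<Longrightarrow> (F has_derivative F' z) (at z)"
    and cont: "\<And>w. continuous_on D (\<lambda>z. F' z w)"
    using stem_C1[OF assms(8,9) F C1] by blast
  interpret slice_stem v m D f F F'
    using assms(8,9) F F' by unfold_locales auto
  have \<Omega>: "\<Omega> = axial_set D \<inter> span (v ` {..m})"
    using assms(10) by (simp add: M)
  have \<Omega>_iff: "x \<in> \<Omega> - real_line \<longleftrightarrow> x \<in> span (v ` {..m}) \<and> pt x \<in> D - \<real>" for x
    unfolding \<Omega> by (rule Omega_nonreal_iff)
  have c: "c \<noteq> 0"
    using assms(6,14) by simp
  have a: "\<forall>x\<in>\<Omega> - real_line. Gamma_op v m f x = (real m - 1) *\<^sub>R (alg_Im x * spherical_deriv f x)"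
    using Gamma_slice \<Omega>_iff by blast
  have b: "\<forall>x\<in>\<Omega> - real_line. dbar_op v m f x = slice_dxc D M f x + c *\<^sub>R spherical_deriv f x"
    using dbar_slice \<Omega>_iff unfolding M assms(14) by blast
  have c1: "\<forall>x\<in>\<Omega> - real_line. d_op v m f x = slice_dx D M f x - c *\<^sub>R spherical_deriv f x"
    using d_slice \<Omega>_iff unfolding M assms(14) by blast
  have c2: "\<forall>x\<in>\<Omega> - real_line.
      slice_dx (D - \<real>) M (spherical_deriv f) x = d_op v m (spherical_deriv f) x"
    using d_spherical \<Omega>_iff unfolding M by metis
  have d0: "slice_regular D M f \<longleftrightarrow> (\<forall>x\<in>\<Omega> - real_line. slice_dxc D M f x = 0)"
    unfolding M \<Omega> by (rule slice_regular_iff_slice_dxc[OF cont])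
  then have d: "slice_regular D M f \<longleftrightarrow> (\<forall>x\<in>\<Omega> - real_line. dbar_op v m f x = c *\<^sub>R spherical_deriv f x)"
    using b by simp
  have e: "(\<forall>x\<in>\<Omega>. dbar_op v m f x = 0) \<longleftrightarrow>
      (\<forall>x\<in>\<Omega> - real_line. slice_dxc D M f x = - (c *\<^sub>R spherical_deriv f x))"
  proof -
    have "(\<forall>x\<in>\<Omega>. dbar_op v m f x = 0) \<longleftrightarrow> (\<forall>x\<in>\<Omega> - real_line. dbar_op v m f x = 0)"
      using dbar_zero_extend[OF C1] unfolding \<Omega> by blast
    also have "\<dots> \<longleftrightarrow> (\<forall>x\<in>\<Omega> - real_line. slice_dxc D M f x = - (c *\<^sub>R spherical_deriv f x))"
      using b by (simp add: eq_neg_iff_add_eq_0)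
    finally show ?thesis .
  qed
  have f: "laplace_op v m f x = (4 * c) *\<^sub>R slice_dx (D - \<real>) M (spherical_deriv f) x \<and>
      alg_Im x * laplace_op v m f x = (2 * c) *\<^sub>R (slice_dx D M f x - spherical_deriv f x)"
    if reg: "slice_regular D M f" and x: "x \<in> \<Omega> - real_line" for x
  proof -
    have x': "x \<in> span (v ` {..m})" "pt x \<in> D - \<real>" "pt x \<in> D"
      using x \<Omega>_iff by auto
    have cr: "F' (pt x) \<i> = iota_mult (F' (pt x) 1)"
      using reg x'(3) by (simp add: M slice_regular_iff)
    note lap = laplace_slice[OF reg[unfolded M] x'(1,2)]
    have 4: "4 * c = - 2 * (real m - 1)"
      by (simp add: assms(14))
    have "laplace_op v m f x = (4 * c) *\<^sub>R slice_dx (D - \<real>) M (spherical_deriv f) x"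
      unfolding lap M slice_dx_spherical[OF x'(1,2)] 4 by (simp add: scaleR_diff_right algebra_simps)
    moreover have "alg_Im x * laplace_op v m f x = (2 * c) *\<^sub>R (slice_dx D M f x - spherical_deriv f x)"
    proof -
      have N: "N x \<noteq> 0"
        using x' by (simp add: pt_real_iff)
      have "alg_Im x * (unit x * y) = - (N x *\<^sub>R y)" for y
        using N_unit[of x] imag_unitsD(3)[OF unit_imag_unit[of x], of y] x'(1)
        by (simp add: alg_Im_M alg_scaleR_left flip: N_unit)
      then have "alg_Im x * laplace_op v m f x =
          (real m - 1) *\<^sub>R (- (N x *\<^sub>R G' (pt x) \<i>) - V x * G' (pt x) 1)"
        using x'(1) by (simp add: lap alg_scaleR_right alg.diff_right alg_Im_M)
      also have "\<dots> = (2 * c) *\<^sub>R (fst (F' (pt x) 1) - G (pt x) + unit x * snd (F' (pt x) 1))"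
      proof -
        have "2 * c = - (real m - 1)"
          by (simp add: assms(14))
        moreover have "- (N x *\<^sub>R G' (pt x) \<i>) - V x * G' (pt x) 1 =
            - (fst (F' (pt x) 1) - G (pt x) + unit x * snd (F' (pt x) 1))"
          using cr by (simp add: N_G'[OF x'(1,2)] V_G'[OF x'(1,2)] iota_mult_def)
        ultimately show ?thesis
          by (simp only: scaleR_minus_left scaleR_minus_right)
      qed
      also have "fst (F' (pt x) 1) - G (pt x) + unit x * snd (F' (pt x) 1) = slice_dx D M f x - spherical_deriv f x"
        using cr by (simp add: M slice_dxs[OF x'(1,2)] spherical_deriv_at[OF x'(1,2)] iota_mult_def
            alg_scaleR_right scaleR_add_right flip: scaleR_2)
      finally show ?thesis .
    qed
    ultimately show ?thesis ..
  qed
  have g1: "locally_constant_on \<Omega> f" if "\<forall>x\<in>\<Omega>. dbar_op v m f x = 0" and reg: "slice_regular D M f"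
  proof -
    \<comment> \<open>Regularity gives
      \<open>dbar_op v m f x = c *\<^sub>R spherical_deriv f x\<close>; the left side vanishes and c
      is nonzero because m > 1.\<close>
    have "spherical_deriv f x = 0" if "x \<in> \<Omega> - real_line" for x
      using that \<open>\<forall>x\<in>\<Omega>. dbar_op v m f x = 0\<close> reg d c by auto
    then have "G (pt x) = 0" if "x \<in> span (v ` {..m})" "pt x \<in> D - \<real>" for x
      using that spherical_deriv_at[OF that] \<Omega>_iff by simp
    note snd = snd_F_eq_0[OF this]
    have cr: "F' z \<i> = iota_mult (F' z 1)" if "z \<in> D" for z
      using reg that by (simp add: M slice_regular_iff)
    have "fst (F' z 1) = 0 \<and> fst (F' z \<i>) = 0" if "z \<in> D" for z
      using snd_F'_eq_0[OF snd that, of 1] snd_F'_eq_0[OF snd that, of \<i>] cr[OF that]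
      by (simp add: iota_mult_def)
    then show ?thesis
      unfolding \<Omega> using locally_constant_slice[OF snd] by blast
  qed
  have g2: "locally_constant_on \<Omega> f"
    if "\<forall>x\<in>\<Omega>. d_op v m f x = 0" and dx: "\<forall>x\<in>\<Omega>. slice_dx D M f x = 0"
  proof -
    have "spherical_deriv f x = 0" if "x \<in> \<Omega> - real_line" for x
      using that \<open>\<forall>x\<in>\<Omega>. d_op v m f x = 0\<close> dx c1 c by auto
    then have "G (pt x) = 0" if "x \<in> span (v ` {..m})" "pt x \<in> D - \<real>" for x
      using that spherical_deriv_at[OF that] \<Omega>_iff by simp
    note snd = snd_F_eq_0[OF this]
    \<comment> \<open>Since \<open>F_2 = 0\<close>, this is twice the stem function of the slice
      derivative, which vanishes by assumption.\<close>
    define \<Phi> where "\<Phi> z = (fst (F' z 1), - fst (F' z \<i>))" for z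
    have "\<Phi> z = 0" if "z \<in> D" for z
    proof (rule stem_zero_of_slice_zero'[OF open_D cnj_D _ _ _ that, of \<Phi>])
      show "continuous_on D \<Phi>"
        unfolding \<Phi>_def by (intro continuous_intros cont)
      show "stem_function D \<Phi>"
        by (simp add: stem_function_def \<Phi>_def stem_F' F'_minus cplx_bar_def)
      fix x assume "x \<in> span (v ` {..m})" "pt x \<in> D" "N x \<noteq> 0"
      then have x: "x \<in> span (v ` {..m})" "pt x \<in> D - \<real>"
        by (auto simp: pt_real_iff)
      then have "slice_dx D M f x = 0"
        using dx \<Omega>_iff by auto
      then show "fst (\<Phi> (pt x)) + unit x * snd (\<Phi> (pt x)) = 0"
        using slice_dxs(1)[OF x] snd_F'_eq_0[OF snd \<open>pt x \<in> D\<close>] by (simp add: M \<Phi>_def)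
    qed
    then have "fst (F' z 1) = 0" "fst (F' z \<i>) = 0" if "z \<in> D" for z
      using that by (auto simp: \<Phi>_def prod_eq_iff)
    then show ?thesis
      unfolding \<Omega> using locally_constant_slice[OF snd] by blast
  qed
  have h: "\<exists>a b. \<forall>x\<in>C. f x = x * a + b"
    if "slice_regular D M f" "\<forall>x\<in>\<Omega>. laplace_op v m f x = 0" "C \<in> components \<Omega>" for C
    using affine_slice[OF that(1)[unfolded M] assms(6) _ that(3)[unfolded \<Omega>]] that(2) unfolding \<Omega> by blast
  show ?thesis
    using a b c1 c2 d e
  proof (intro conjI)
    show "slice_regular D M f \<longrightarrow> (\<forall>x\<in>\<Omega> - real_line.
           laplace_op v m f x = (4 * c) *\<^sub>R slice_dx (D - \<real>) M (spherical_deriv f) x \<and>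
           alg_Im x * laplace_op v m f x = (2 * c) *\<^sub>R (slice_dx D M f x - spherical_deriv f x))"
      using f by blast
    show "(\<forall>x\<in>\<Omega>. dbar_op v m f x = 0) \<and> slice_regular D M f \<longrightarrow> locally_constant_on \<Omega> f"
      using g1 by blast
    show "(\<forall>x\<in>\<Omega>. d_op v m f x = 0) \<and> (\<forall>x\<in>\<Omega>. slice_dx D M f x = 0) \<longrightarrow>
        locally_constant_on \<Omega> f"
      using g2 by blast
    show "slice_regular D M f \<and> (\<forall>x\<in>\<Omega>. laplace_op v m f x = 0) \<longrightarrow>
        (\<forall>C\<in>components \<Omega>. \<exists>a b. \<forall>x\<in>C. f x = x * a + b)"
      using h by blast
  qed
qed

end
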